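(* Let $\mathsf{V}$ be a finitely axiomatizable and locally finite variety of finite type, and let $\boldsymbol{F}_{\mathsf{V}}(\aleph_0)$ be its free algebra on countably infinitely many free generators. If the universal theory $\mathsf{Th}_\forall(\boldsymbol{F}_{\mathsf{V}}(\aleph_0))$ is recursively axiomatizable, then it is also decidable.
   Context: A variety is a class of similar algebras axiomatized by equations; it is of finite type when its language has finitely many operation symbols, and locally finite when all finitely generated subalgebras of its members are finite. $\boldsymbol{F}_{\mathsf{V}}(\aleph_0)$ is the quotient of the term algebra over countably infinitely many variables by the congruence identifying terms $t,s$ with $\mathsf{V}\vDash t\approx s$. $\mathsf{Th}_\forall(\boldsymbol{A})$ is the set of universal sentences ($\forall x_1,\dots,x_n\,P$ with $P$ quantifier-free) valid in $\boldsymbol{A}$. It is recursively axiomatizable when there is a recursive set of sentences with the same models, and decidable when membership in it is decidable by an algorithm. *)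

theory Defs
  imports Main "HOL-Library.Nat_Bijection"
begin

text \<open>Operation symbols are natural numbers. A language is a partial map from symbols to
  arities: its symbols are the elements of its domain, which may be empty. Symbols of arity
  0 are constants.\<close>

type_synonym lang = "nat \<rightharpoonup> nat"

definition finite_type :: "lang \<Rightarrow> bool" where
  "finite_type L \<longleftrightarrow> finite (dom L)"

datatype trm = Var nat | Fn nat "trm list"

fun is_term :: "lang \<Rightarrow> trm \<Rightarrow> bool" where
  "is_term L (Var n) \<longleftrightarrow> True"
| "is_term L (Fn f ts) \<longleftrightarrow> L f = Some (length ts) \<and> (\<forall>t\<in>set ts. is_term L t)"

fun tvars :: "trm \<Rightarrow> nat set" where
  "tvars (Var n) = {n}"
| "tvars (Fn f ts) = (\<Union>t\<in>set ts. tvars t)"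

text \<open>Equality, negation, conjunction and universal quantification; the other connectives and
  the existential quantifier are definable from these.\<close>

datatype fm = Eq trm trm | Neg fm | Conj fm fm | Forall nat fm

primrec is_fm :: "lang \<Rightarrow> fm \<Rightarrow> bool" where
  "is_fm L (Eq t s) \<longleftrightarrow> is_term L t \<and> is_term L s"
| "is_fm L (Neg p) \<longleftrightarrow> is_fm L p"
| "is_fm L (Conj p q) \<longleftrightarrow> is_fm L p \<and> is_fm L q"
| "is_fm L (Forall x p) \<longleftrightarrow> is_fm L p"

primrec fvars :: "fm \<Rightarrow> nat set" where
  "fvars (Eq t s) = tvars t \<union> tvars s"
| "fvars (Neg p) = fvars p"
| "fvars (Conj p q) = fvars p \<union> fvars q"
| "fvars (Forall x p) = fvars p - {x}"

primrec qfree :: "fm \<Rightarrow> bool" where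
  "qfree (Eq t s) \<longleftrightarrow> True"
| "qfree (Neg p) \<longleftrightarrow> qfree p"
| "qfree (Conj p q) \<longleftrightarrow> qfree p \<and> qfree q"
| "qfree (Forall x p) \<longleftrightarrow> False"

definition sentences :: "lang \<Rightarrow> fm set" where
  "sentences L = {p. is_fm L p \<and> fvars p = {}}"

definition universal_sentences :: "lang \<Rightarrow> fm set" where
  "universal_sentences L = {p \<in> sentences L. \<exists>xs q. qfree q \<and> p = foldr Forall xs q}"

text \<open>The values of \<open>oper\<close> outside the symbols and arities of the language, or outside the
  carrier, are irrelevant.\<close>

record 'a alg =
  carrier :: "'a set"
  oper :: "nat \<Rightarrow> 'a list \<Rightarrow> 'a"

definition algebra :: "lang \<Rightarrow> 'a alg \<Rightarrow> bool" where
  "algebra L A \<longleftrightarrow> carrier A \<noteq> {} \<and>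
     (\<forall>f n xs. L f = Some n \<longrightarrow> length xs = n \<longrightarrow> set xs \<subseteq> carrier A \<longrightarrow> oper A f xs \<in> carrier A)"

primrec eval :: "'a alg \<Rightarrow> (nat \<Rightarrow> 'a) \<Rightarrow> trm \<Rightarrow> 'a" where
  "eval A v (Var n) = v n"
| "eval A v (Fn f ts) = oper A f (map (eval A v) ts)"

primrec sat :: "'a alg \<Rightarrow> (nat \<Rightarrow> 'a) \<Rightarrow> fm \<Rightarrow> bool" where
  "sat A v (Eq t s) \<longleftrightarrow> eval A v t = eval A v s"
| "sat A v (Neg p) \<longleftrightarrow> \<not> sat A v p"
| "sat A v (Conj p q) \<longleftrightarrow> sat A v p \<and> sat A v q"
| "sat A v (Forall x p) \<longleftrightarrow> (\<forall>a\<in>carrier A. sat A (v(x := a)) p)"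

text \<open>Free variables are read as universally quantified; in particular \<open>valid A (Eq t s)\<close> says
  that the equation \<open>t \<approx> s\<close> holds in \<open>A\<close>.\<close>

definition valid :: "'a alg \<Rightarrow> fm \<Rightarrow> bool" where
  "valid A p \<longleftrightarrow> (\<forall>v. range v \<subseteq> carrier A \<longrightarrow> sat A v p)"

text \<open>Classes of algebras are sets of algebras whose carriers are subsets of a type \<open>'a\<close>, HOL
  having no proper classes. It has to be infinite: then, by the Loewenheim-Skolem theorem, all
  notions below that refer to all algebras or all models do not depend on the choice of \<open>'a\<close>,
  languages being countable.\<close>

definition Mod :: "lang \<Rightarrow> fm set \<Rightarrow> 'a alg set" where
  "Mod L S = {A. algebra L A \<and> (\<forall>p\<in>S. valid A p)}"

definition equations :: "lang \<Rightarrow> fm set" where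
  "equations L = {Eq t s |t s. is_term L t \<and> is_term L s}"

definition variety :: "lang \<Rightarrow> 'a alg set \<Rightarrow> bool" where
  "variety L V \<longleftrightarrow> (\<exists>E \<subseteq> equations L. V = Mod L E)"

text \<open>The axioms may be arbitrary first-order sentences. For a variety this is equivalent to
  having a finite set of equational axioms, by compactness.\<close>

definition finitely_axiomatizable :: "lang \<Rightarrow> 'a alg set \<Rightarrow> bool" where
  "finitely_axiomatizable L V \<longleftrightarrow> (\<exists>S \<subseteq> sentences L. finite S \<and> V = Mod L S)"

inductive_set generated :: "lang \<Rightarrow> 'a alg \<Rightarrow> 'a set \<Rightarrow> 'a set"
  for L :: lang and A :: "'a alg" and X :: "'a set" where
  base: "x \<in> X \<Longrightarrow> x \<in> generated L A X"
| step: "L f = Some (length xs) \<Longrightarrow> (\<And>x. x \<in> set xs \<Longrightarrow> x \<in> generated L A X)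
    \<Longrightarrow> oper A f xs \<in> generated L A X"

definition locally_finite :: "lang \<Rightarrow> 'a alg set \<Rightarrow> bool" where
  "locally_finite L V \<longleftrightarrow>
     (\<forall>A\<in>V. \<forall>X. finite X \<and> X \<subseteq> carrier A \<longrightarrow> finite (generated L A X))"

definition free_cong :: "lang \<Rightarrow> 'a alg set \<Rightarrow> (trm \<times> trm) set" where
  "free_cong L V = {(t, s). is_term L t \<and> is_term L s \<and> (\<forall>A\<in>V. valid A (Eq t s))}"

text \<open>The quotient of the algebra of all terms over the variables \<open>Var 0, Var 1, \<dots>\<close>. An operation
  sends classes to the class of the terms built from any of their representatives.\<close>

definition free_alg :: "lang \<Rightarrow> 'a alg set \<Rightarrow> trm set alg" where
  "free_alg L V =
     \<lparr>carrier = {t. is_term L t} // free_cong L V,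
      oper = (\<lambda>f cs. free_cong L V `` {Fn f ts |ts. list_all2 (\<in>) ts cs})\<rparr>"

definition universal_theory :: "lang \<Rightarrow> 'b alg \<Rightarrow> fm set" where
  "universal_theory L A = {p \<in> universal_sentences L. valid A p}"

text \<open>\<open>recfun n f\<close> says that \<open>f\<close>, restricted to lists of length \<open>n\<close>, is an \<open>n\<close>-ary total recursive
  function: these are generated from the initial functions by composition, primitive recursion
  and minimization of regular functions. Values on lists of other lengths are irrelevant.\<close>

inductive recfun :: "nat \<Rightarrow> (nat list \<Rightarrow> nat) \<Rightarrow> bool" where
  zero: "recfun n (\<lambda>xs. 0)"
| suc: "recfun 1 (\<lambda>xs. Suc (xs ! 0))"
| proj: "i < n \<Longrightarrow> recfun n (\<lambda>xs. xs ! i)"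
| comp: "recfun (length gs) f \<Longrightarrow> (\<And>g. g \<in> set gs \<Longrightarrow> recfun n g)
    \<Longrightarrow> recfun n (\<lambda>xs. f (map (\<lambda>g. g xs) gs))"
| prim_rec: "recfun n f \<Longrightarrow> recfun (Suc (Suc n)) g
    \<Longrightarrow> recfun (Suc n) (\<lambda>xs. rec_nat (f (tl xs)) (\<lambda>k r. g (k # r # tl xs)) (hd xs))"
| minim: "recfun (Suc n) f \<Longrightarrow> (\<And>xs. length xs = n \<Longrightarrow> \<exists>y. f (y # xs) = 0)
    \<Longrightarrow> recfun n (\<lambda>xs. LEAST y. f (y # xs) = 0)"

definition recursive_set :: "nat set \<Rightarrow> bool" where
  "recursive_set N \<longleftrightarrow> (\<exists>f. recfun 1 f \<and> (\<forall>x. f [x] = (if x \<in> N then 1 else 0)))"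

text \<open>Goedel numbers, through Cantor's pairing function and its extension to lists.\<close>

primrec trm_code :: "trm \<Rightarrow> nat" where
  "trm_code (Var n) = prod_encode (0, n)"
| "trm_code (Fn f ts) = prod_encode (1, prod_encode (f, list_encode (map trm_code ts)))"

primrec fm_code :: "fm \<Rightarrow> nat" where
  "fm_code (Eq t s) = prod_encode (0, prod_encode (trm_code t, trm_code s))"
| "fm_code (Neg p) = prod_encode (1, fm_code p)"
| "fm_code (Conj p q) = prod_encode (2, prod_encode (fm_code p, fm_code q))"
| "fm_code (Forall x p) = prod_encode (3, prod_encode (x, fm_code p))"

lemma trm_code_inject: "trm_code t = trm_code s \<longleftrightarrow> t = s"
proof (induction t arbitrary: s)
  case (Var n)
  then show ?case by (cases s) auto
next
  case (Fn f ts)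
  show ?case
  proof (cases s)
    case (Fn g ss)
    have "map trm_code ts = map trm_code ss \<Longrightarrow> ts = ss"
      using Fn.IH by (auto simp: list_eq_iff_nth_eq dest!: map_eq_imp_length_eq)
    then show ?thesis using Fn by (auto simp: list_encode_eq)
  qed simp
qed

lemma fm_code_inject: "fm_code p = fm_code q \<longleftrightarrow> p = q"
proof (induction p arbitrary: q)
  case (Eq t s)
  then show ?case by (cases q) (auto simp: trm_code_inject)
next
  case (Neg p)
  then show ?case by (cases q) auto
next
  case (Conj p1 p2)
  then show ?case by (cases q) auto
next
  case (Forall x p)
  then show ?case by (cases q) auto
qed

definition decidable :: "fm set \<Rightarrow> bool" where
  "decidable S \<longleftrightarrow> recursive_set (fm_code ` S)"

text \<open>The type argument is the type of the elements of the models.\<close>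

definition recursively_axiomatizable :: "'a itself \<Rightarrow> lang \<Rightarrow> fm set \<Rightarrow> bool" where
  "recursively_axiomatizable _ L T \<longleftrightarrow>
     (\<exists>S \<subseteq> sentences L. decidable S \<and> (Mod L S :: 'a alg set) = Mod L T)"

end

theory Submission
  imports Defs
begin

text \<open>Let \<open>T\<close> be the universal theory of the free algebra, axiomatized by the recursive set \<open>S\<close>. A
  universal sentence belongs to \<open>T\<close> iff it follows from \<open>S\<close>, so by a completeness theorem \<open>T\<close> is
  semidecidable; in particular, so is the congruence defining the free algebra. Conversely, if
  \<open>t \<approx> s\<close> fails in \<open>V\<close>, then by local finiteness it fails in a finite algebra of \<open>V\<close>, and as
  \<open>V\<close> is finitely axiomatizable, a search through the finite algebras will find one. Hence the
  congruence is decidable. A universal sentence outside \<open>T\<close> is then recognized by a substitution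
  of terms for its variables that makes its matrix false, and \<open>T\<close> is decidable because both \<open>T\<close>
  and its complement are semidecidable.\<close>

section \<open>Recursive functions through pairing\<close>

text \<open>Two obstacles shape the proof. Recursiveness is given only through the generators of
  \<open>recfun\<close>, so every syntactic operation has to be shown recursive on codes. Rather
  than programming each recursion, the proof establishes once that a set generated by semidecidable
  rules is semidecidable, a derivation being a list that can be checked. A function satisfying a
  well-founded recursion then has a semidecidable graph and is recursive; the same fact makes
  refutability semidecidable. The other obstacle is that \<open>S\<close> and \<open>T\<close> are
  only known to have the same models with carriers in \<open>'a\<close>, whereas the free algebra
  and the models supplied by completeness consist of classes of terms. Both are quotients of the
  term algebra, hence countable, and have isomorphic copies over the infinite type
  \<open>'a\<close>. The congruence of the free algebra inherits semidecidability from
  \<open>T\<close> because an equation holds throughout \<open>V\<close> iff it is valid in the free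
  algebra, the equations of \<open>V\<close> being closed under substitution.\<close>

definition pair :: "nat \<Rightarrow> nat \<Rightarrow> nat" where "pair a b = prod_encode (a, b)"
definition pfst :: "nat \<Rightarrow> nat" where "pfst z = fst (prod_decode z)"
definition psnd :: "nat \<Rightarrow> nat" where "psnd z = snd (prod_decode z)"

lemma pfst_pair [simp]: "pfst (pair a b) = a"
  and psnd_pair [simp]: "psnd (pair a b) = b"
  and pair_pfst_psnd [simp]: "pair (pfst z) (psnd z) = z"
  by (simp_all add: pair_def pfst_def psnd_def)

lemma pair_eq_iff [simp]: "pair a b = pair c d \<longleftrightarrow> a = c \<and> b = d"
  by (simp add: pair_def)

lemma pair_ge: "a \<le> pair a b" "b \<le> pair a b"
  by (simp_all add: pair_def le_prod_encode_1 le_prod_encode_2)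

text \<open>Later on, several arguments are packed into one number by \<open>pair\<close>, so that
  closure rules can be stated for unary functions; \<open>recursive2\<close> mainly bridges the gap
  until \<open>pair\<close> and its projections are known to be recursive.\<close>

definition recursive :: "(nat \<Rightarrow> nat) \<Rightarrow> bool" where
  "recursive f \<longleftrightarrow> recfun 1 (\<lambda>xs. f (xs ! 0))"

definition recursive2 :: "(nat \<Rightarrow> nat \<Rightarrow> nat) \<Rightarrow> bool" where
  "recursive2 f \<longleftrightarrow> recfun 2 (\<lambda>xs. f (xs ! 0) (xs ! 1))"

definition decid :: "(nat \<Rightarrow> bool) \<Rightarrow> bool" where
  "decid P \<longleftrightarrow> recursive (\<lambda>x. if P x then 1 else 0)"

lemma recfun_comp1: "recfun 1 f \<Longrightarrow> recfun n g \<Longrightarrow> recfun n (\<lambda>xs. f [g xs])"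
  using recfun.comp[of "[g]" f n] by simp

lemma recfun_comp2:
  "recfun 2 f \<Longrightarrow> recfun n g \<Longrightarrow> recfun n h \<Longrightarrow> recfun n (\<lambda>xs. f [g xs, h xs])"
  using recfun.comp[of "[g, h]" f n] by (auto simp: numeral_2_eq_2)

lemma recursive_comp: "recursive f \<Longrightarrow> recursive g \<Longrightarrow> recursive (\<lambda>x. f (g x))"
  unfolding recursive_def using recfun_comp1[of "\<lambda>xs. f (xs ! 0)" 1] by fastforce

lemma recursive2_comp:
  "recursive2 f \<Longrightarrow> recursive g \<Longrightarrow> recursive h \<Longrightarrow> recursive (\<lambda>x. f (g x) (h x))"
  unfolding recursive_def recursive2_def
  using recfun_comp2[of "\<lambda>xs. f (xs ! 0) (xs ! 1)" 1] by fastforce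

lemma recursive2_swap: "recursive2 f \<Longrightarrow> recursive2 (\<lambda>x y. f y x)"
  unfolding recursive2_def
  using recfun_comp2[OF _ recfun.proj[of 1 2] recfun.proj[of 0 2]] by fastforce

lemma recursive2_comp_outer: "recursive f \<Longrightarrow> recursive2 g \<Longrightarrow> recursive2 (\<lambda>x y. f (g x y))"
  unfolding recursive_def recursive2_def
  using recfun_comp1[of "\<lambda>xs. f (xs ! 0)" 2] by fastforce

lemma recursive2_comp_fst: "recursive2 f \<Longrightarrow> recursive g \<Longrightarrow> recursive2 (\<lambda>x y. f (g x) y)"
  unfolding recursive_def recursive2_def
  using recfun_comp2[OF _ recfun_comp1[OF _ recfun.proj[of 0 2]] recfun.proj[of 1 2],
      of "\<lambda>xs. f (xs ! 0) (xs ! 1)" "\<lambda>xs. g (xs ! 0)"] by simp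

lemma recursive2_comp2:
  "recursive2 f \<Longrightarrow> recursive2 g \<Longrightarrow> recursive2 h \<Longrightarrow> recursive2 (\<lambda>x y. f (g x y) (h x y))"
  unfolding recursive2_def
  using recfun_comp2[of "\<lambda>xs. f (xs ! 0) (xs ! 1)" 2] by fastforce

lemma recursive_id: "recursive (\<lambda>x. x)"
  unfolding recursive_def by (rule recfun.proj) simp

lemma recursive_Suc: "recursive f \<Longrightarrow> recursive (\<lambda>x. Suc (f x))"
  using recursive_comp[of Suc f] recfun.suc by (simp add: recursive_def)

lemma recursive_const: "recursive (\<lambda>x. c)"
proof (induction c)
  case 0
  show ?case unfolding recursive_def by (rule recfun.zero)
qed (rule recursive_Suc)

lemma recursive2_prim:
  assumes f: "recursive f" and g: "recfun 3 (\<lambda>xs. g (xs ! 0) (xs ! 1) (xs ! 2))"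
  shows "recursive2 (\<lambda>n a. rec_nat (f a) (\<lambda>k r. g k r a) n)"
proof -
  have "recfun (Suc 1) (\<lambda>xs. rec_nat (f (tl xs ! 0))
      (\<lambda>k r. g ((k # r # tl xs) ! 0) ((k # r # tl xs) ! 1) ((k # r # tl xs) ! 2)) (hd xs))"
    by (rule recfun.prim_rec) (use assms in \<open>simp_all add: recursive_def numeral_3_eq_3\<close>)
  from recfun_comp2[OF _ recfun.proj[of 0 2] recfun.proj[of 1 2], OF this[simplified, folded numeral_2_eq_2]]
  show ?thesis unfolding recursive2_def by simp
qed

lemma recfun3_proj:
  "recfun 3 (\<lambda>xs. xs ! 0)" "recfun 3 (\<lambda>xs. xs ! 1)" "recfun 3 (\<lambda>xs. xs ! 2)"
  by (rule recfun.proj; simp)+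

lemma recfun3_comp1: "recursive f \<Longrightarrow> recfun 3 g \<Longrightarrow> recfun 3 (\<lambda>xs. f (g xs))"
  using recfun_comp1[of "\<lambda>xs. f (xs ! 0)" 3 g] by (simp add: recursive_def)

lemma recfun3_comp2: "recursive2 f \<Longrightarrow> recfun 3 g \<Longrightarrow> recfun 3 h \<Longrightarrow> recfun 3 (\<lambda>xs. f (g xs) (h xs))"
  using recfun_comp2[of "\<lambda>xs. f (xs ! 0) (xs ! 1)" 3 g h] by (simp add: recursive2_def)

text \<open>Iteration is the form in which primitive recursion is mostly used: addition iterates the
  successor, truncated subtraction the predecessor, and access to list entries the tail.\<close>

lemma recursive2_funpow: "recursive f \<Longrightarrow> recursive2 (\<lambda>n a. (f ^^ n) a)"
proof -
  assume "recursive f"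
  have "recursive2 (\<lambda>n a. rec_nat a (\<lambda>k r. f r) n)"
    by (rule recursive2_prim[OF recursive_id recfun3_comp1[OF \<open>recursive f\<close> recfun3_proj(2)]])
  moreover have "rec_nat a (\<lambda>k r. f r) n = (f ^^ n) a" for n a
    by (induction n) auto
  ultimately show ?thesis by simp
qed

lemma recursive2_add: "recursive2 (+)"
proof -
  have "(Suc ^^ n) a = n + a" for n a by (induction n) auto
  then show ?thesis using recursive2_funpow[OF recursive_Suc[OF recursive_id]] by simp
qed

lemma recursive_pred: "recursive (\<lambda>x. x - 1)"
proof -
  have "recursive2 (\<lambda>n a. rec_nat 0 (\<lambda>k r. k) n)"
    by (intro recursive2_prim recursive_const recfun3_proj)
  moreover have "rec_nat 0 (\<lambda>k r. k) n = n - 1" for n by (cases n) auto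
  ultimately show ?thesis
    using recursive2_comp[of "\<lambda>n a. n - 1" "\<lambda>x. x" "\<lambda>x. x"] recursive_id by simp
qed

lemma recursive2_diff: "recursive2 (-)"
proof -
  have "((\<lambda>x. x - 1) ^^ n) a = a - n" for n a by (induction n arbitrary: a) auto
  then show ?thesis
    using recursive2_swap[OF recursive2_funpow[OF recursive_pred]] by simp
qed

lemma recursive_triangle: "recursive triangle"
proof -
  have "recursive2 (\<lambda>n a. rec_nat 0 (\<lambda>k r. r + Suc k) n)"
    by (intro recursive2_prim recursive_const recfun3_comp2[OF recursive2_add]
        recfun3_comp1[OF recursive_Suc[OF recursive_id]] recfun3_proj)
  moreover have "rec_nat 0 (\<lambda>k r. r + Suc k) n = triangle n" for n by (induction n) auto
  ultimately show ?thesis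
    using recursive2_comp[of "\<lambda>n a. triangle n" "\<lambda>x. x" "\<lambda>x. x"] recursive_id by simp
qed

lemma recursive_Least_zero:
  assumes "recursive2 f" and "\<And>x. \<exists>y. f y x = 0"
  shows "recursive (\<lambda>x. LEAST y. f y x = 0)"
proof -
  have "recfun 1 (\<lambda>xs. LEAST y. f ((y # xs) ! 0) ((y # xs) ! 1) = 0)"
    by (rule recfun.minim) (use assms in \<open>auto simp: recursive2_def numeral_2_eq_2\<close>)
  then show ?thesis by (simp add: recursive_def)
qed

section \<open>Unpairing and closure rules for recursive functions\<close>

named_theorems recur

lemmas [recur] = recursive_id recursive_const recursive_Suc

lemma recursive_add [recur]: "recursive f \<Longrightarrow> recursive g \<Longrightarrow> recursive (\<lambda>x. f x + g x)"
  by (rule recursive2_comp[OF recursive2_add])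

lemma recursive_diff [recur]: "recursive f \<Longrightarrow> recursive g \<Longrightarrow> recursive (\<lambda>x. f x - g x :: nat)"
  by (rule recursive2_comp[OF recursive2_diff])

lemma triangle_mono: "m \<le> n \<Longrightarrow> triangle m \<le> triangle n"
  by (induction rule: dec_induct) auto

text \<open>Cantor's pairing sends \<open>(a, b)\<close> to \<open>triangle (a + b) + a\<close>, so
  \<open>a + b\<close> is the least \<open>y\<close> with \<open>z < triangle (Suc y)\<close>.
  Truncated subtraction turns this inequality into an equation with 0, as minimization
  demands.\<close>

lemma Least_triangle: "(LEAST y. Suc z - triangle (Suc y) = 0) = pfst z + psnd z"
proof (rule Least_equality)
  have z: "z = triangle (pfst z + psnd z) + pfst z"
    using pair_pfst_psnd[of z] by (simp add: pair_def prod_encode_def)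
  then show "Suc z - triangle (Suc (pfst z + psnd z)) = 0" by simp
  fix y assume "Suc z - triangle (Suc y) = 0"
  show "pfst z + psnd z \<le> y"
  proof (rule ccontr)
    assume "\<not> pfst z + psnd z \<le> y"
    then have "triangle (Suc y) \<le> triangle (pfst z + psnd z)" by (intro triangle_mono) simp
    with z \<open>Suc z - triangle (Suc y) = 0\<close> show False by linarith
  qed
qed

lemma recursive_pfst_plus_psnd: "recursive (\<lambda>z. pfst z + psnd z)"
proof -
  have "recursive (\<lambda>z. LEAST y. Suc z - triangle (Suc y) = 0)"
  proof (rule recursive_Least_zero)
    show "\<exists>y. Suc z - triangle (Suc y) = 0" for z
      by (rule exI[of _ z]) simp
    have "recursive2 (\<lambda>z y. Suc z - triangle (Suc y))"
      using recursive2_comp_fst[OF recursive2_swap[OF recursive2_comp_fst[OF recursive2_swap[OF recursive2_diff]]]]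
        recursive_comp[OF recursive_triangle recursive_Suc[OF recursive_id]] recursive_Suc[OF recursive_id]
      by blast
    then show "recursive2 (\<lambda>y z. Suc z - triangle (Suc y))"
      by (rule recursive2_swap)
  qed
  then show ?thesis unfolding Least_triangle .
qed

lemma pfst_conv: "pfst z = z - triangle (pfst z + psnd z)"
  using pair_pfst_psnd[of z] by (simp add: pair_def prod_encode_def)

lemma recursive_pfst [recur]: "recursive f \<Longrightarrow> recursive (\<lambda>x. pfst (f x))"
proof (rule recursive_comp[of pfst])
  have "recursive (\<lambda>z. z - triangle (pfst z + psnd z))"
    by (intro recur recursive_comp[OF recursive_triangle] recursive_pfst_plus_psnd)
  then show "recursive pfst" by (simp flip: pfst_conv)
qed

lemma recursive_psnd [recur]: "recursive f \<Longrightarrow> recursive (\<lambda>x. psnd (f x))"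
proof (rule recursive_comp[of psnd])
  have "recursive (\<lambda>z. pfst z + psnd z - pfst z)"
    by (intro recur recursive_pfst_plus_psnd)
  then show "recursive psnd" by simp
qed

lemma recursive2_pair: "recursive2 pair"
  unfolding pair_def prod_encode_def prod.case
  using recursive2_comp2[OF recursive2_add recursive2_comp_outer[OF recursive_triangle recursive2_add]]
    recfun.proj[of 0 2] by (simp add: recursive2_def)

lemma recursive_pair [recur]: "recursive f \<Longrightarrow> recursive g \<Longrightarrow> recursive (\<lambda>x. pair (f x) (g x))"
  by (rule recursive2_comp[OF recursive2_pair])

lemma recursive_comp2:
  assumes "recursive (\<lambda>z. F (pfst z) (psnd z))" "recursive f" "recursive g"
  shows "recursive (\<lambda>x. F (f x) (g x))"
  using recursive_comp[OF assms(1) recursive_pair[OF assms(2,3)]] by simp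

lemma recursive2I: "recursive (\<lambda>z. F (pfst z) (psnd z)) \<Longrightarrow> recursive2 F"
  using recursive2_comp_outer[OF _ recursive2_pair] by fastforce

lemma recursive_funpow:
  "recursive F \<Longrightarrow> recursive f \<Longrightarrow> recursive g \<Longrightarrow> recursive (\<lambda>x. (F ^^ f x) (g x))"
  by (rule recursive2_comp[OF recursive2_funpow])

lemma recursive_if [recur]:
  assumes "decid P" "recursive f" "recursive g"
  shows "recursive (\<lambda>x. if P x then f x else g x)"
proof -
  \<comment> \<open>Case distinction as a primitive recursion of length 0 or 1: the base returns
    \<open>g x\<close>, the step \<open>f x\<close>, both packed into the parameter.\<close>
  have "recursive2 (\<lambda>n a. rec_nat (psnd a) (\<lambda>k r. pfst a) n)"
    by (rule recursive2_prim[OF recursive_psnd[OF recursive_id]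
          recfun3_comp1[OF recursive_pfst[OF recursive_id] recfun3_proj(3)]])
  from recursive2_comp[OF this assms(1)[unfolded decid_def] recursive_pair[OF assms(2,3)]]
  have "recursive (\<lambda>x. rec_nat (psnd (pair (f x) (g x))) (\<lambda>k r. pfst (pair (f x) (g x))) (if P x then 1 else 0))" .
  moreover have "rec_nat (psnd (pair (f x) (g x))) (\<lambda>k r. pfst (pair (f x) (g x))) (if P x then 1 else 0)
      = (if P x then f x else g x)" for x
    by simp
  ultimately show ?thesis by simp
qed

section \<open>Decidable predicates\<close>

lemma decid_comp: "decid P \<Longrightarrow> recursive f \<Longrightarrow> decid (\<lambda>x. P (f x))"
  unfolding decid_def by (rule recursive_comp)

lemma decid_comp2:
  assumes "decid (\<lambda>z. P (pfst z) (psnd z))" "recursive f" "recursive g"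
  shows "decid (\<lambda>x. P (f x) (g x))"
  using decid_comp[OF assms(1) recursive_pair[OF assms(2,3)]] by simp

lemma decid_const [recur]: "decid (\<lambda>x. b)"
  unfolding decid_def by (rule recursive_const)

lemma decid_not [recur]: "decid P \<Longrightarrow> decid (\<lambda>x. \<not> P x)"
proof -
  assume "decid P"
  then have "recursive (\<lambda>x. if P x then 0 else 1)" by (intro recur)
  moreover have "(if P x then 0 else 1) = (if \<not> P x then 1 else 0 :: nat)" for x by simp
  ultimately show ?thesis unfolding decid_def by simp
qed

lemma decid_conj [recur]: "decid P \<Longrightarrow> decid Q \<Longrightarrow> decid (\<lambda>x. P x \<and> Q x)"
proof -
  assume "decid P" "decid Q"
  then have "recursive (\<lambda>x. if P x then if Q x then 1 else 0 else 0)" by (intro recur)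
  moreover have "(if P x then if Q x then 1 else 0 else 0) = (if P x \<and> Q x then 1 else 0 :: nat)" for x
    by simp
  ultimately show ?thesis unfolding decid_def by simp
qed

lemma decid_disj [recur]: "decid P \<Longrightarrow> decid Q \<Longrightarrow> decid (\<lambda>x. P x \<or> Q x)"
  using decid_not[OF decid_conj[OF decid_not[of P] decid_not[of Q]]] by simp

lemma decid_le [recur]: "recursive f \<Longrightarrow> recursive g \<Longrightarrow> decid (\<lambda>x. f x \<le> g x)"
proof -
  assume "recursive f" "recursive g"
  then have "recursive (\<lambda>x. 1 - (f x - g x))" by (intro recur)
  moreover have "(\<lambda>x. 1 - (f x - g x)) = (\<lambda>x. if f x \<le> g x then 1 else 0)" by auto
  ultimately show ?thesis unfolding decid_def by simp
qed

lemma decid_less [recur]: "recursive f \<Longrightarrow> recursive g \<Longrightarrow> decid (\<lambda>x. f x < g x)"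
  using decid_not[OF decid_le[of g f]] by (simp add: not_le)

lemma decid_eq [recur]: "recursive f \<Longrightarrow> recursive g \<Longrightarrow> decid (\<lambda>x. f x = g x)"
  using decid_conj[OF decid_le[of f g] decid_le[of g f]] by (simp add: eq_iff)

lemma recursive_Least:
  assumes "decid (\<lambda>z. P (pfst z) (psnd z))" "\<And>x. \<exists>y. P x y"
  shows "recursive (\<lambda>x. LEAST y. P x y)"
proof -
  have "recursive (\<lambda>x. LEAST y. (if P x y then 0 else 1) = (0::nat))"
  proof (rule recursive_Least_zero[where f = "\<lambda>y x. if P x y then 0 else 1"])
    show "recursive2 (\<lambda>y x. if P x y then 0 else 1)"
      by (intro recursive2I recur decid_comp2[OF assms(1)])
  qed (use assms(2) in auto)
  moreover have "((if P x y then 0 else 1) = (0::nat)) = P x y" for x y by simp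
  ultimately show ?thesis by simp
qed

lemma decid_ball_less [recur]:
  assumes "decid (\<lambda>z. P (pfst z) (psnd z))" "recursive b"
  shows "decid (\<lambda>x. \<forall>i<b x. P x i)"
proof -
  \<comment> \<open>The alternative \<open>y = b x\<close> makes the minimization regular: without a
    violation of \<open>P x\<close> below the bound, the search stops at the bound itself.\<close>
  let ?l = "\<lambda>x. LEAST y. y = b x \<or> \<not> P x y"
  have "recursive ?l"
    by (rule recursive_Least) (intro recur assms recursive_comp[OF assms(2)], blast)
  moreover have "(\<forall>i<b x. P x i) \<longleftrightarrow> b x \<le> ?l x" for x
  proof
    assume "\<forall>i<b x. P x i"
    then show "b x \<le> ?l x"
      by (metis (mono_tags, lifting) LeastI_ex not_le order_refl)
  next
    assume "b x \<le> ?l x"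
    then show "\<forall>i<b x. P x i"
      using not_less_Least[of _ "\<lambda>y. y = b x \<or> \<not> P x y"] by (meson order_less_le_trans)
  qed
  ultimately show ?thesis using assms(2) decid_le by simp
qed

lemma decid_finite: "finite A \<Longrightarrow> decid (\<lambda>x. x \<in> A)"
  by (induction rule: finite_induct) (auto intro!: recur)

lemma decid_ball_finite: "finite A \<Longrightarrow> (\<And>a. a \<in> A \<Longrightarrow> decid (P a)) \<Longrightarrow> decid (\<lambda>x. \<forall>a\<in>A. P a x)"
  by (induction rule: finite_induct) (auto intro!: recur)

lemma recursive_set_iff_decid: "recursive_set A \<longleftrightarrow> decid (\<lambda>x. x \<in> A)"
proof
  assume "recursive_set A"
  then obtain f where "recfun 1 f" "\<And>x. f [x] = (if x \<in> A then 1 else 0)"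
    unfolding recursive_set_def by blast
  then show "decid (\<lambda>x. x \<in> A)"
    using recfun_comp1[of f 1 "\<lambda>xs. xs ! 0"] recfun.proj[of 0 1] by (simp add: decid_def recursive_def)
next
  assume "decid (\<lambda>x. x \<in> A)"
  then show "recursive_set A"
    unfolding recursive_set_def decid_def recursive_def by fastforce
qed

section \<open>Lists, semidecidability and inductive closure\<close>

definition lcons :: "nat \<Rightarrow> nat \<Rightarrow> nat" where "lcons a l = Suc (pair a l)"
definition ltl :: "nat \<Rightarrow> nat" where "ltl l = psnd (l - 1)"
definition llen :: "nat \<Rightarrow> nat" where "llen l = length (list_decode l)"
definition lnth :: "nat \<Rightarrow> nat \<Rightarrow> nat" where
  "lnth l i = (if i < llen l then list_decode l ! i else 0)"
definition ltab :: "(nat \<Rightarrow> nat) \<Rightarrow> nat \<Rightarrow> nat" where "ltab f n = list_encode (map f [0..<n])"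
definition lmap :: "(nat \<Rightarrow> nat) \<Rightarrow> nat \<Rightarrow> nat" where "lmap f l = list_encode (map f (list_decode l))"

lemma list_decode_lcons [simp]: "list_decode (lcons a l) = a # list_decode l"
  by (simp add: lcons_def pair_def)

lemma list_encode_Cons: "list_encode (a # xs) = lcons a (list_encode xs)"
  by (simp add: lcons_def pair_def)

lemma list_decode_lmap [simp]: "list_decode (lmap f l) = map f (list_decode l)"
  by (simp add: lmap_def)

lemma list_decode_ltab [simp]: "list_decode (ltab f n) = map f [0..<n]"
  by (simp add: ltab_def)

lemma list_decode_eq_iff [simp]: "list_decode l = list_decode m \<longleftrightarrow> l = m"
  by (metis list_decode_inverse)

lemma list_decode_eq_Nil [simp]: "list_decode l = [] \<longleftrightarrow> l = 0"
  by (metis list_decode.simps(1) list_decode_eq_iff)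

lemma lnth_code [simp]: "i < length (list_decode l) \<Longrightarrow> lnth l i = list_decode l ! i"
  by (simp add: lnth_def llen_def)

lemma llen_code [simp]: "llen (list_encode xs) = length xs"
  by (simp add: llen_def)

lemma ltl_lcons [simp]: "ltl (lcons a l) = l"
  by (simp add: ltl_def lcons_def)

lemma list_decode_ltl [simp]: "list_decode (ltl l) = tl (list_decode l)"
proof (cases l)
  case 0
  \<comment> \<open>The tail of the empty list is computed as \<open>psnd (0 - 1)\<close>, which has
    to be 0 again.\<close>
  have "pair 0 0 = 0" by (simp add: pair_def prod_encode_def)
  then have "psnd 0 = 0" by (metis psnd_pair)
  then show ?thesis using 0 by (simp add: ltl_def)
next
  case (Suc m)
  then have l: "l = lcons (pfst m) (psnd m)" by (simp add: lcons_def)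
  show ?thesis unfolding l by (simp only: ltl_lcons list_decode_lcons list.sel)
qed

lemma list_decode_funpow_ltl [simp]: "list_decode ((ltl ^^ n) l) = drop n (list_decode l)"
  by (induction n arbitrary: l) (simp_all add: drop_Suc tl_drop)

text \<open>The successor in the code of a nonempty list makes the inequality strict. Strictness
  drives the termination of decoding and the freshness condition of the calculus.\<close>

lemma member_list_encode_less: "x \<in> set xs \<Longrightarrow> x < list_encode xs"
proof (induction xs)
  case (Cons a xs)
  have "a < list_encode (a # xs)" "list_encode xs < list_encode (a # xs)"
    unfolding list_encode_Cons lcons_def less_Suc_eq_le by (rule pair_ge)+
  with Cons.IH Cons.prems show ?case by (metis order_less_trans set_ConsD)
qed simp

lemma member_list_decode_less: "x \<in> set (list_decode l) \<Longrightarrow> x < l"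
  using member_list_encode_less[of x "list_decode l"] by simp

lemma recursive_lcons [recur]: "recursive f \<Longrightarrow> recursive g \<Longrightarrow> recursive (\<lambda>x. lcons (f x) (g x))"
  unfolding lcons_def by (intro recur)

lemma recursive_ltl: "recursive ltl"
  unfolding ltl_def by (intro recur)

lemma funpow_ltl_eq_0_iff: "(ltl ^^ n) l = 0 \<longleftrightarrow> llen l \<le> n"
  using list_decode_eq_Nil[of "(ltl ^^ n) l"] by (simp add: llen_def del: list_decode_eq_Nil)

lemma recursive_llen [recur]: "recursive f \<Longrightarrow> recursive (\<lambda>x. llen (f x))"
proof (rule recursive_comp[of llen])
  have "recursive (\<lambda>l. LEAST n. (ltl ^^ n) l = 0)"
    by (rule recursive_Least)
      (intro recur recursive_funpow recursive_ltl, auto simp: funpow_ltl_eq_0_iff)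
  moreover have "(LEAST n. (ltl ^^ n) l = 0) = llen l" for l
    unfolding funpow_ltl_eq_0_iff by (rule Least_equality) auto
  ultimately show "recursive llen" by simp
qed

lemma lnth_conv: "lnth l i = (if i < llen l then pfst ((ltl ^^ i) l - 1) else 0)"
proof (cases "i < llen l")
  case True
  then have "(ltl ^^ i) l = lcons (list_decode l ! i) (list_encode (drop (Suc i) (list_decode l)))"
    by (intro list_decode_eq_iff[THEN iffD1]) (simp add: llen_def Cons_nth_drop_Suc)
  then show ?thesis using True by (simp add: lcons_def lnth_def)
qed (simp add: lnth_def)

lemma recursive_lnth [recur]:
  "recursive f \<Longrightarrow> recursive g \<Longrightarrow> recursive (\<lambda>x. lnth (f x) (g x))"
  unfolding lnth_conv by (intro recur recursive_funpow recursive_ltl)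

text \<open>Exactly one number decodes to a list with the required length and entries, so an
  unbounded search for it succeeds and replaces a recursion that builds the list.\<close>

lemma recursive_ltab [recur]:
  assumes "recursive (\<lambda>z. F (pfst z) (psnd z))" "recursive n"
  shows "recursive (\<lambda>x. ltab (F x) (n x))"
proof -
  let ?P = "\<lambda>x r. llen r = n x \<and> (\<forall>i<n x. lnth r i = F x i)"
  have P: "?P x r \<longleftrightarrow> r = ltab (F x) (n x)" for x r
  proof -
    have "?P x r \<longleftrightarrow> list_decode r = map (F x) [0..<n x]"
      by (auto simp: llen_def list_eq_iff_nth_eq)
    then show ?thesis by (metis list_decode_inverse list_decode_ltab)
  qed
  have "recursive (\<lambda>x. LEAST r. ?P x r)"
  proof (rule recursive_Least)
    show "decid (\<lambda>z. ?P (pfst z) (psnd z))"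
      by (intro recur recursive_comp[OF assms(2)] recursive_comp2[OF assms(1)])
    show "\<exists>r. ?P x r" for x by (simp add: P)
  qed
  moreover have "(LEAST r. ?P x r) = ltab (F x) (n x)" for x
    unfolding P by (rule Least_equality) auto
  ultimately show ?thesis by simp
qed

lemma lmap_conv: "lmap f l = ltab (\<lambda>i. f (lnth l i)) (llen l)"
proof -
  have "map f (list_decode l) = map (\<lambda>i. f (lnth l i)) [0..<llen l]"
    by (rule nth_equalityI) (simp_all add: llen_def)
  then show ?thesis by (simp only: lmap_def ltab_def)
qed

lemma recursive_lmap [recur]:
  assumes "recursive (\<lambda>z. F (pfst z) (psnd z))" "recursive l"
  shows "recursive (\<lambda>x. lmap (F x) (l x))"
  unfolding lmap_conv by (intro recur recursive_comp2[OF assms(1)] recursive_comp[OF assms(2)] assms(2))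

lemma decid_ball_list [recur]:
  assumes "decid (\<lambda>z. P (pfst z) (psnd z))" "recursive l"
  shows "decid (\<lambda>x. \<forall>y\<in>set (list_decode (l x)). P x y)"
proof -
  have "decid (\<lambda>x. \<forall>i<llen (l x). P x (lnth (l x) i))"
    by (intro recur decid_comp2[OF assms(1)] recursive_comp[OF assms(2)] assms(2))
  then show ?thesis by (simp add: llen_def all_set_conv_all_nth)
qed

lemma decid_bex_list [recur]:
  assumes "decid (\<lambda>z. P (pfst z) (psnd z))" "recursive l"
  shows "decid (\<lambda>x. \<exists>y\<in>set (list_decode (l x)). P x y)"
  using decid_not[OF decid_ball_list[of "\<lambda>x y. \<not> P x y", OF decid_not[OF assms(1)] assms(2)]]
  by simp

lemma decid_member_list [recur]:
  "recursive f \<Longrightarrow> recursive l \<Longrightarrow> decid (\<lambda>x. f x \<in> set (list_decode (l x)))"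
  using decid_bex_list[of "\<lambda>x y. f x = y" l]
  by (simp add: decid_eq recursive_comp recursive_pfst recursive_psnd recursive_id)

lemma recursive_of_bool [recur]: "decid P \<Longrightarrow> recursive (\<lambda>x. of_bool (P x))"
  by (simp add: decid_def of_bool_def)

section \<open>Semidecidable predicates\<close>

definition semidecid :: "(nat \<Rightarrow> bool) \<Rightarrow> bool" where
  "semidecid P \<longleftrightarrow> (\<exists>D. decid D \<and> (\<forall>x. P x \<longleftrightarrow> (\<exists>w. D (pair x w))))"

named_theorems semi

lemma semidecid_decid: "decid P \<Longrightarrow> semidecid P"
  unfolding semidecid_def
  using decid_comp[OF _ recursive_pfst[OF recursive_id], of P] by (intro exI[of _ "\<lambda>z. P (pfst z)"]) auto

lemma semidecid_comp: "semidecid P \<Longrightarrow> recursive f \<Longrightarrow> semidecid (\<lambda>x. P (f x))"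
proof -
  assume "semidecid P" and f: "recursive f"
  then obtain D where D: "decid D" "\<And>x. P x \<longleftrightarrow> (\<exists>w. D (pair x w))"
    unfolding semidecid_def by blast
  have "decid (\<lambda>z. D (pair (f (pfst z)) (psnd z)))"
    by (intro decid_comp[OF D(1)] recursive_pair recursive_comp[OF f] recur)
  then show ?thesis unfolding semidecid_def D(2) by (intro exI conjI) auto
qed

lemma semidecid_ex [semi]:
  assumes "semidecid (\<lambda>z. P (pfst z) (psnd z))"
  shows "semidecid (\<lambda>x. \<exists>y. P x y)"
proof -
  obtain D where D: "decid D" "\<And>z. P (pfst z) (psnd z) \<longleftrightarrow> (\<exists>w. D (pair z w))"
    using assms unfolding semidecid_def by blast
  have "decid (\<lambda>z. D (pair (pair (pfst z) (pfst (psnd z))) (psnd (psnd z))))"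
    by (intro decid_comp[OF D(1)] recur)
  moreover have "(\<exists>y. P x y) \<longleftrightarrow> (\<exists>w. D (pair (pair x (pfst w)) (psnd w)))" for x
    using D(2)[of "pair x _"] by (auto, metis pfst_pair psnd_pair)
  ultimately show ?thesis unfolding semidecid_def by (intro exI conjI) auto
qed

lemma semidecid_conj [semi]:
  assumes "semidecid P" "semidecid Q" shows "semidecid (\<lambda>x. P x \<and> Q x)"
proof -
  obtain D E where D: "decid D" "\<And>z. P z \<longleftrightarrow> (\<exists>w. D (pair z w))"
    and E: "decid E" "\<And>z. Q z \<longleftrightarrow> (\<exists>w. E (pair z w))"
    using assms unfolding semidecid_def by blast
  have "semidecid (\<lambda>x. \<exists>v. \<exists>w. D (pair x v) \<and> E (pair x w))"
    by (intro semidecid_ex semidecid_decid recur decid_comp[OF D(1)] decid_comp[OF E(1)])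
  then show ?thesis by (simp add: D(2) E(2))
qed

lemma semidecid_disj [semi]:
  assumes "semidecid P" "semidecid Q" shows "semidecid (\<lambda>x. P x \<or> Q x)"
proof -
  obtain D E where D: "decid D" "\<And>z. P z \<longleftrightarrow> (\<exists>w. D (pair z w))"
    and E: "decid E" "\<And>z. Q z \<longleftrightarrow> (\<exists>w. E (pair z w))"
    using assms unfolding semidecid_def by blast
  have "semidecid (\<lambda>x. \<exists>v. D (pair x v) \<or> E (pair x v))"
    by (intro semidecid_ex semidecid_decid recur decid_comp[OF D(1)] decid_comp[OF E(1)])
  then show ?thesis by (simp add: D(2) E(2) ex_disj_distrib)
qed

text \<open>Post's theorem. A single search looks for a witness of either side, and the answer is
  read off from the kind of witness found.\<close>

lemma decid_of_semidecid:
  assumes "semidecid P" "semidecid (\<lambda>x. \<not> P x)" shows "decid P"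
proof -
  obtain D E where D: "decid D" "\<And>z. P z \<longleftrightarrow> (\<exists>w. D (pair z w))"
    and E: "decid E" "\<And>z. \<not> P z \<longleftrightarrow> (\<exists>w. E (pair z w))"
    using assms unfolding semidecid_def by blast
  let ?m = "\<lambda>x. LEAST w. D (pair x w) \<or> E (pair x w)"
  have ex: "\<exists>w. D (pair x w) \<or> E (pair x w)" for x
    using D(2)[of x] E(2)[of x] by metis
  have "recursive ?m"
    by (rule recursive_Least) (intro recur decid_comp[OF D(1)] decid_comp[OF E(1)], rule ex)
  then have "decid (\<lambda>x. D (pair x (?m x)))"
    by (intro decid_comp[OF D(1)] recursive_pair recur)
  moreover have "D (pair x (?m x)) \<longleftrightarrow> P x" for x
  proof -
    have "D (pair x (?m x)) \<or> E (pair x (?m x))" by (rule LeastI_ex[OF ex])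
    then show ?thesis using D(2)[of x] E(2)[of x] by metis
  qed
  ultimately show ?thesis by simp
qed

text \<open>The search runs over pairs of a value and a witness that this value is right. It ends
  because \<open>f\<close> is total, and the first component of the result is the value.\<close>

lemma recursive_of_graph:
  assumes "semidecid (\<lambda>z. f (pfst z) = psnd z)" shows "recursive f"
proof -
  obtain D where D: "decid D" "\<And>z. f (pfst z) = psnd z \<longleftrightarrow> (\<exists>w. D (pair z w))"
    using assms unfolding semidecid_def by blast
  let ?m = "\<lambda>x. LEAST w. D (pair (pair x (pfst w)) (psnd w))"
  have ex: "\<exists>w. D (pair (pair x (pfst w)) (psnd w))" for x
    using D(2)[of "pair x (f x)"] by (metis pfst_pair psnd_pair)
  have "recursive ?m"
    by (rule recursive_Least) (intro recur decid_comp[OF D(1)], rule ex)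
  then have "recursive (\<lambda>x. pfst (?m x))" by (rule recursive_pfst)
  moreover have "pfst (?m x) = f x" for x
  proof -
    have "D (pair (pair x (pfst (?m x))) (psnd (?m x)))" by (rule LeastI_ex[OF ex])
    then show ?thesis using D(2)[of "pair x (pfst (?m x))"] unfolding pfst_pair psnd_pair by metis
  qed
  ultimately show ?thesis by simp
qed

section \<open>Inductive generation and course-of-values recursion\<close>

text \<open>The premises come as the code of one list, so that rules with any finite number of
  premises, axioms included, form a single binary relation on numbers.\<close>

inductive rule_closure :: "(nat \<Rightarrow> nat \<Rightarrow> bool) \<Rightarrow> nat \<Rightarrow> bool" for R where
  "R ps c \<Longrightarrow> (\<And>p. p \<in> set (list_decode ps) \<Longrightarrow> rule_closure R p) \<Longrightarrow> rule_closure R c"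

text \<open>A derivation is a list of triples (conclusion, premises, witness that the rule applies), in
  which the premises of every triple are conclusions of later triples.\<close>

lemma semidecid_rule_closure:
  assumes "semidecid (\<lambda>z. R (pfst z) (psnd z))"
  shows "semidecid (rule_closure R)"
proof -
  obtain D where D: "decid D" "\<And>z. R (pfst z) (psnd z) \<longleftrightarrow> (\<exists>w. D (pair z w))"
    using assms unfolding semidecid_def by blast
  define ok where "ok e T \<longleftrightarrow> D (pair (pair (pfst (psnd e)) (pfst e)) (psnd (psnd e))) \<and>
    (\<forall>y\<in>set (list_decode (pfst (psnd e))). \<exists>e'\<in>set T. pfst e' = y)" for e T
  define derivation where "derivation T \<longleftrightarrow> (\<forall>i<length T. ok (T ! i) (drop (Suc i) T))" for T
  have Nil: "derivation []" by (simp add: derivation_def)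
  have Cons: "derivation (e # T) \<longleftrightarrow> ok e T \<and> derivation T" for e T
    by (auto simp: derivation_def All_less_Suc2)
  have mono: "ok e T \<Longrightarrow> set T \<subseteq> set T' \<Longrightarrow> ok e T'" for e T T'
    unfolding ok_def by blast
  \<comment> \<open>A step stays correct when more steps follow it, so the derivations of all
    premises of a rule can be concatenated.\<close>
  have append: "derivation T \<Longrightarrow> derivation T' \<Longrightarrow> derivation (T @ T')" for T T'
    by (induction T) (auto simp: Cons intro: mono)
  have sound: "derivation T \<Longrightarrow> \<forall>e\<in>set T. rule_closure R (pfst e)" for T
  proof (induction T)
    case (Cons e T)
    then have IH: "\<forall>e\<in>set T. rule_closure R (pfst e)" and ok: "ok e T"
      by (auto simp: \<open>\<And>e T. derivation (e # T) \<longleftrightarrow> ok e T \<and> derivation T\<close>)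
    have "R (pfst (psnd e)) (pfst e)"
      using ok D(2)[of "pair (pfst (psnd e)) (pfst e)"] by (auto simp: ok_def)
    then have "rule_closure R (pfst e)"
      by (rule rule_closure.intros) (use ok IH in \<open>auto simp: ok_def\<close>)
    with IH show ?case by simp
  qed simp
  have complete: "\<exists>T. derivation T \<and> (\<exists>e\<in>set T. pfst e = c)" if "rule_closure R c" for c
    using that
  proof induction
    case (1 ps c)
    have "\<exists>T. derivation T \<and> set ys \<subseteq> pfst ` set T" if "set ys \<subseteq> set (list_decode ps)" for ys
      using that
    proof (induction ys)
      case (Cons y ys)
      then obtain T where "derivation T" "set ys \<subseteq> pfst ` set T" by auto
      moreover obtain T' e where "derivation T'" "e \<in> set T'" "pfst e = y" using "1.IH"[of y] Cons.prems by auto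
      ultimately show ?case by (intro exI[of _ "T @ T'"]) (auto intro: append)
    qed (auto intro: Nil)
    then obtain T where T: "derivation T" "set (list_decode ps) \<subseteq> pfst ` set T" by blast
    obtain w where w: "D (pair (pair ps c) w)" using 1(1) D(2)[of "pair ps c"] by auto
    have "ok (pair c (pair ps w)) T" using w T(2) by (fastforce simp: ok_def)
    with T(1) show ?case by (intro exI[of _ "pair c (pair ps w) # T"]) (simp add: Cons)
  qed
  have "rule_closure R = (\<lambda>c. \<exists>t. derivation (list_decode t) \<and> (\<exists>e\<in>set (list_decode t). pfst e = c))"
  proof (intro ext iffI)
    fix c assume "rule_closure R c"
    then obtain T where "derivation T" "\<exists>e\<in>set T. pfst e = c" using complete by blast
    then show "\<exists>t. derivation (list_decode t) \<and> (\<exists>e\<in>set (list_decode t). pfst e = c)"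
      by (intro exI[of _ "list_encode T"]) simp
  qed (use sound in blast)
  moreover have "decid (\<lambda>t. derivation (list_decode t))"
  proof -
    have "decid (\<lambda>t. \<forall>i<llen t. ok (lnth t i) (list_decode ((ltl ^^ Suc i) t)))"
      unfolding ok_def by (intro recur decid_comp[OF D(1)] recursive_funpow recursive_ltl)
    then show ?thesis by (simp add: derivation_def llen_def del: funpow.simps)
  qed
  note [recur] = decid_comp[OF this]
  have "semidecid (\<lambda>c. \<exists>t. derivation (list_decode t) \<and> (\<exists>e\<in>set (list_decode t). pfst e = c))"
    by (intro semidecid_ex semidecid_decid recur)
  ultimately show ?thesis by simp
qed

text \<open>Here \<open>deps x\<close> codes the list of arguments at which values are required, and
  \<open>H\<close> computes \<open>f x\<close> from these values. Reading this as a rule that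
  derives the point \<open>pair x (f x)\<close> from the points over \<open>deps x\<close> makes the
  graph of \<open>f\<close> a rule closure; the measure \<open>m\<close> ensures that every point of
  the graph is derived.\<close>

lemma recursive_wf_rec:
  assumes deps: "recursive deps" and H: "recursive H"
    and f: "\<And>x. f x = H (pair x (lmap f (deps x)))"
    and less: "\<And>x y. y \<in> set (list_decode (deps x)) \<Longrightarrow> m y < (m x :: nat)"
  shows "recursive f"
proof (rule recursive_of_graph)
  define R where "R ps c \<longleftrightarrow> lmap pfst ps = deps (pfst c) \<and> psnd c = H (pair (pfst c) (lmap psnd ps))"
    for ps c
  have "semidecid (\<lambda>z. R (pfst z) (psnd z))"
    unfolding R_def by (intro semidecid_decid recur recursive_comp[OF deps] recursive_comp[OF H])
  then have *: "semidecid (rule_closure R)" by (rule semidecid_rule_closure)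
  have "rule_closure R c \<Longrightarrow> f (pfst c) = psnd c" for c
  proof (induction rule: rule_closure.induct)
    case (1 ps c)
    have "lmap f (deps (pfst c)) = lmap psnd ps"
      using 1 by (subst list_decode_eq_iff[symmetric], subst list_decode_lmap)
        (simp add: R_def del: list_decode_lmap, metis (mono_tags, lifting) list.map_comp list_decode_lmap map_eq_conv o_apply)
    with 1(1) show ?case by (simp add: R_def f[of "pfst c"])
  qed
  moreover have "rule_closure R (pair x (f x))" for x
  proof (induction "m x" arbitrary: x rule: less_induct)
    case less
    show ?case
    proof (rule rule_closure.intros)
      show "R (lmap (\<lambda>y. pair y (f y)) (deps x)) (pair x (f x))"
        by (simp add: R_def f[of x]) (simp add: lmap_def comp_def)
    qed (use less assms(4) in auto)
  qed
  ultimately have "rule_closure R = (\<lambda>c. f (pfst c) = psnd c)"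
    by (intro ext) (metis pair_pfst_psnd)
  with * show "semidecid (\<lambda>z. f (pfst z) = psnd z)" by simp
qed

section \<open>Decoding terms and formulas\<close>

lemma psnd_le: "psnd c \<le> c" and pfst_le: "pfst c \<le> c"
  using pair_ge[of "pfst c" "psnd c"] pair_ge[where a = "pfst c" and b = "psnd c"] by simp_all

text \<open>Strict descent requires a nonzero tag, as \<open>pair 0 0 = 0\<close>. The tag 0 marks
  variables and equations, below which the decoding of terms or formulas does not call
  itself.\<close>

lemma psnd_less: "pfst c \<noteq> 0 \<Longrightarrow> psnd c < c"
proof -
  assume "pfst c \<noteq> 0"
  have "n \<le> triangle n" for n by (induction n) auto
  from this[of "pfst c + psnd c"] have "pfst c + psnd c + pfst c \<le> pair (pfst c) (psnd c)"
    by (simp add: pair_def prod_encode_def del: pair_pfst_psnd)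
  with \<open>pfst c \<noteq> 0\<close> show ?thesis by simp
qed

lemma member_args_less: "x \<in> set (list_decode (psnd (psnd c))) \<Longrightarrow> x < c"
  using member_list_decode_less[of x "psnd (psnd c)"] psnd_le[of c] psnd_le[of "psnd c"] by linarith

text \<open>Every number is read as a term and as a formula, so that no well-formedness checks
  are needed on codes.\<close>

function trm_of :: "nat \<Rightarrow> trm" where
  "trm_of c = (if pfst c = 0 then Var (psnd c)
     else Fn (pfst (psnd c)) (map trm_of (list_decode (psnd (psnd c)))))"
  by auto
termination by (relation "measure id") (auto dest: member_args_less)

function fm_of :: "nat \<Rightarrow> fm" where
  "fm_of c = (if pfst c = 0 then Eq (trm_of (pfst (psnd c))) (trm_of (psnd (psnd c)))
     else if pfst c = 1 then Neg (fm_of (psnd c))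
     else if pfst c = 2 then Conj (fm_of (pfst (psnd c))) (fm_of (psnd (psnd c)))
     else Forall (pfst (psnd c)) (fm_of (psnd (psnd c))))"
  by auto
termination
proof (relation "measure id")
  fix c :: nat assume c: "pfst c \<noteq> 0"
  show "(psnd c, c) \<in> measure id" using psnd_less[OF c] by simp
  show "(pfst (psnd c), c) \<in> measure id" using psnd_less[OF c] pfst_le[of "psnd c"] by simp
  show "(psnd (psnd c), c) \<in> measure id" using psnd_less[OF c] psnd_le[of "psnd c"] by simp
  show "(psnd (psnd c), c) \<in> measure id" using psnd_less[OF c] psnd_le[of "psnd c"] by simp
qed simp

declare trm_of.simps [simp del] fm_of.simps [simp del]

lemma trm_of_pair [simp]:
  "trm_of (pair 0 n) = Var n"
  "trm_of (pair (Suc k) (pair f ts)) = Fn f (map trm_of (list_decode ts))"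
  by (subst trm_of.simps; simp)+

lemma fm_of_pair [simp]:
  "fm_of (pair 0 (pair t s)) = Eq (trm_of t) (trm_of s)"
  "fm_of (pair (Suc 0) p) = Neg (fm_of p)"
  "fm_of (pair 2 (pair p q)) = Conj (fm_of p) (fm_of q)"
  "fm_of (pair 3 (pair x p)) = Forall x (fm_of p)"
  by (subst fm_of.simps; simp)+

lemma trm_code_pair:
  "trm_code (Var n) = pair 0 n"
  "trm_code (Fn f ts) = pair (Suc 0) (pair f (list_encode (map trm_code ts)))"
  by (simp_all add: pair_def)

lemma fm_code_pair:
  "fm_code (Eq t s) = pair 0 (pair (trm_code t) (trm_code s))"
  "fm_code (Neg p) = pair (Suc 0) (fm_code p)"
  "fm_code (Conj p q) = pair 2 (pair (fm_code p) (fm_code q))"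
  "fm_code (Forall x p) = pair 3 (pair x (fm_code p))"
  by (simp_all add: pair_def)

lemma trm_of_code [simp]: "trm_of (trm_code t) = t"
  by (induction t) (simp_all add: trm_code_pair map_idI del: trm_code.simps)

lemma fm_of_code [simp]: "fm_of (fm_code p) = p"
  by (induction p) (simp_all add: fm_code_pair del: fm_code.simps)

lemma tvars_trm_of_le: "x \<in> tvars (trm_of c) \<Longrightarrow> x \<le> c"
proof (induction c rule: less_induct)
  case (less c)
  show ?case
  proof (cases "pfst c = 0")
    case True
    then have "trm_of c = Var (psnd c)" by (subst trm_of.simps) simp
    with less.prems psnd_le[of c] show ?thesis by simp
  next
    case False
    then have "tvars (trm_of c) = (\<Union>d\<in>set (list_decode (psnd (psnd c))). tvars (trm_of d))"
      by (subst trm_of.simps) simp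
    with less.prems obtain d where "d \<in> set (list_decode (psnd (psnd c)))" "x \<in> tvars (trm_of d)"
      by blast
    with member_args_less[of d c] less.IH[of d] show ?thesis by simp
  qed
qed

lemma fvars_fm_of_le: "x \<in> fvars (fm_of c) \<Longrightarrow> x \<le> c"
proof (induction c rule: less_induct)
  case (less c)
  have *: "pfst (psnd c) \<le> c" "psnd (psnd c) \<le> c"
    using pfst_le[of "psnd c"] psnd_le[of "psnd c"] psnd_le[of c] by simp_all
  show ?case
  proof (cases "pfst c = 0")
    case True
    then show ?thesis using less.prems * tvars_trm_of_le[of x "pfst (psnd c)"] tvars_trm_of_le[of x "psnd (psnd c)"]
      by (subst (asm) fm_of.simps) auto
  next
    case False
    then have "psnd c < c" "pfst (psnd c) < c" "psnd (psnd c) < c"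
      using psnd_less[of c] pfst_le[of "psnd c"] psnd_le[of "psnd c"] by simp_all
    with False show ?thesis using less.prems less.IH[of "psnd c"] less.IH[of "pfst (psnd c)"]
        less.IH[of "psnd (psnd c)"]
      by (subst (asm) fm_of.simps) (auto split: if_splits)
  qed
qed

section \<open>Structural recursion carried out on codes\<close>

text \<open>The parameter \<open>x\<close> stays fixed during the recursion. In the applications it
  carries a substitution, a list of variables, or a finite algebra together with an
  assignment.\<close>

lemma recursive_trm_fold:
  fixes f :: "nat \<Rightarrow> trm \<Rightarrow> nat"
  assumes "\<And>x n. f x (Var n) = a (pair x n)"
    and "\<And>x g ts. f x (Fn g ts) = b (pair x (pair g (list_encode (map (f x) ts))))"
    and "recursive a" "recursive b"
  shows "recursive (\<lambda>z. f (pfst z) (trm_of (psnd z)))"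
proof (rule recursive_wf_rec[where m = psnd])
  let ?deps = "\<lambda>z. if pfst (psnd z) = 0 then 0 else lmap (pair (pfst z)) (psnd (psnd (psnd z)))"
  let ?H = "\<lambda>w. if pfst (psnd (pfst w)) = 0 then a (pair (pfst (pfst w)) (psnd (psnd (pfst w))))
    else b (pair (pfst (pfst w)) (pair (pfst (psnd (psnd (pfst w)))) (psnd w)))"
  show "recursive ?deps" by (intro recur)
  show "recursive ?H" by (intro recur recursive_comp[OF assms(3)] recursive_comp[OF assms(4)])
  show "f (pfst z) (trm_of (psnd z)) = ?H (pair z (lmap (\<lambda>z. f (pfst z) (trm_of (psnd z))) (?deps z)))" for z
    by (subst trm_of.simps) (simp add: assms(1,2) lmap_def comp_def)
  show "psnd y < psnd z" if "y \<in> set (list_decode (?deps z))" for y z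
    using that member_args_less by (auto split: if_splits)
qed

text \<open>Below a quantifier the parameter may change, and \<open>n x\<close> recursive calls are
  allowed, the \<open>i\<close>-th with the parameter computed by \<open>e\<close>. Satisfaction in
  a finite algebra makes one call for each element of the carrier; the other applications take a
  single call.\<close>

lemma recursive_fm_fold:
  fixes f :: "nat \<Rightarrow> fm \<Rightarrow> nat"
  assumes "\<And>x p. f x (Neg p) = b (f x p)"
    and "\<And>x p q. f x (Conj p q) = c (pair (f x p) (f x q))"
    and "\<And>x y p. f x (Forall y p) = d (pair y (ltab (\<lambda>i. f (e (pair i (pair x y))) p) (n x)))"
    and eq: "recursive (\<lambda>z. f (pfst z) (Eq (trm_of (pfst (psnd z))) (trm_of (psnd (psnd z)))))"
    and "recursive b" "recursive c" "recursive d" "recursive e" "recursive n"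
  shows "recursive (\<lambda>z. f (pfst z) (fm_of (psnd z)))"
proof (rule recursive_wf_rec[where m = psnd])
  let ?deps = "\<lambda>z. if pfst (psnd z) = 0 then 0
    else if pfst (psnd z) = 1 then lcons (pair (pfst z) (psnd (psnd z))) 0
    else if pfst (psnd z) = 2 then
      lcons (pair (pfst z) (pfst (psnd (psnd z)))) (lcons (pair (pfst z) (psnd (psnd (psnd z)))) 0)
    else ltab (\<lambda>i. pair (e (pair i (pair (pfst z) (pfst (psnd (psnd z)))))) (psnd (psnd (psnd z)))) (n (pfst z))"
  let ?H = "\<lambda>w. if pfst (psnd (pfst w)) = 0
      then f (pfst (pfst w)) (Eq (trm_of (pfst (psnd (psnd (pfst w))))) (trm_of (psnd (psnd (psnd (pfst w))))))
    else if pfst (psnd (pfst w)) = 1 then b (lnth (psnd w) 0)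
    else if pfst (psnd (pfst w)) = 2 then c (pair (lnth (psnd w) 0) (lnth (psnd w) 1))
    else d (pair (pfst (psnd (psnd (pfst w)))) (psnd w))"
  show "recursive ?deps"
    by (intro recur recursive_comp[OF \<open>recursive e\<close>] recursive_comp[OF \<open>recursive n\<close>])
  have "recursive (\<lambda>w. f (pfst (pair (pfst (pfst w)) (psnd (psnd (pfst w)))))
     (Eq (trm_of (pfst (psnd (pair (pfst (pfst w)) (psnd (psnd (pfst w)))))))
         (trm_of (psnd (psnd (pair (pfst (pfst w)) (psnd (psnd (pfst w)))))))))"
    by (rule recursive_comp[OF eq]) (intro recur)
  then have "recursive (\<lambda>w. f (pfst (pfst w))
     (Eq (trm_of (pfst (psnd (psnd (pfst w))))) (trm_of (psnd (psnd (psnd (pfst w)))))))"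
    by simp
  then show "recursive ?H"
    by (intro recur recursive_comp[OF \<open>recursive b\<close>] recursive_comp[OF \<open>recursive c\<close>]
        recursive_comp[OF \<open>recursive d\<close>])
  show "f (pfst z) (fm_of (psnd z)) = ?H (pair z (lmap (\<lambda>z. f (pfst z) (fm_of (psnd z))) (?deps z)))" for z
    by (subst fm_of.simps) (simp add: assms(1-3) ltab_def lmap_def comp_def)
  show "psnd y < psnd z" if "y \<in> set (list_decode (?deps z))" for y z
    using that psnd_less[of "psnd z"] pfst_le[of "psnd (psnd z)"] psnd_le[of "psnd (psnd z)"]
    by (auto split: if_splits)
qed

lemma decid_trm_fold:
  assumes "recursive (\<lambda>z. of_bool (P (pfst z) (trm_of (psnd z))))" "recursive f" "recursive g"
  shows "decid (\<lambda>x. P (f x) (trm_of (g x)))"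
  using recursive_comp[OF assms(1) recursive_pair[OF assms(2,3)]] by (simp add: decid_def of_bool_def)

text \<open>A substitution is coded as an association list; a variable that is not listed is mapped to
  itself, \<open>pair 0 n\<close> being the code of \<open>Var n\<close>.\<close>

fun lookup :: "nat list \<Rightarrow> nat \<Rightarrow> nat" where
  "lookup [] n = pair 0 n"
| "lookup (d # ds) n = (if pfst d = n then psnd d else lookup ds n)"

lemma lookup_cases: "lookup ds n = pair 0 n \<or> (\<exists>d\<in>set ds. lookup ds n = psnd d)"
  by (induction ds) auto

lemma recursive_lookup [recur]:
  assumes "recursive f" "recursive g"
  shows "recursive (\<lambda>x. lookup (list_decode (f x)) (g x))"
proof (rule recursive_comp2[OF _ assms])
  show "recursive (\<lambda>z. lookup (list_decode (pfst z)) (psnd z))"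
  proof (rule recursive_wf_rec[where m = "\<lambda>z. llen (pfst z)"])
    let ?deps = "\<lambda>z. if pfst z = 0 then 0 else lcons (pair (ltl (pfst z)) (psnd z)) 0"
    let ?H = "\<lambda>w. if pfst (pfst w) = 0 then pair 0 (psnd (pfst w))
       else if pfst (lnth (pfst (pfst w)) 0) = psnd (pfst w) then psnd (lnth (pfst (pfst w)) 0)
       else lnth (psnd w) 0"
    show "recursive ?deps" by (intro recur recursive_comp[OF recursive_ltl])
    show "recursive ?H" by (intro recur)
    show "lookup (list_decode (pfst z)) (psnd z) =
        ?H (pair z (lmap (\<lambda>z. lookup (list_decode (pfst z)) (psnd z)) (?deps z)))" for z
      by (cases "list_decode (pfst z)") (auto simp flip: list_decode_eq_Nil)
    show "llen (pfst y) < llen (pfst z)" if "y \<in> set (list_decode (?deps z))" for y z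
      using that by (cases "list_decode (pfst z)") (auto simp: llen_def split: if_splits)
  qed
qed

primrec subst :: "(nat \<Rightarrow> trm) \<Rightarrow> trm \<Rightarrow> trm" where
  "subst \<sigma> (Var n) = \<sigma> n"
| "subst \<sigma> (Fn f ts) = Fn f (map (subst \<sigma>) ts)"

definition env :: "nat \<Rightarrow> nat \<Rightarrow> trm" where "env e n = trm_of (lookup (list_decode e) n)"

lemma env_0 [simp]: "env 0 = Var"
  by (simp add: env_def fun_eq_iff)

lemma env_lcons [simp]: "env (lcons (pair x t) e) = (env e)(x := trm_of t)"
  by (simp add: env_def fun_eq_iff)

lemma recursive_trm_code [recur]: "recursive f \<Longrightarrow> recursive (\<lambda>x. trm_code (trm_of (f x)))"
  by (rule recursive_comp2[OF recursive_trm_fold[where f = "\<lambda>_ t. trm_code t"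
        and a = "\<lambda>z. pair 0 (psnd z)" and b = "\<lambda>z. pair (Suc 0) (psnd z)"] recursive_const])
    (simp_all add: trm_code_pair recur del: trm_code.simps)

lemma recursive_subst [recur]:
  assumes "recursive f" "recursive g"
  shows "recursive (\<lambda>x. trm_code (subst (env (f x)) (trm_of (g x))))"
  by (rule recursive_comp2[OF recursive_trm_fold[where f = "\<lambda>e t. trm_code (subst (env e) t)"
        and a = "\<lambda>z. trm_code (trm_of (lookup (list_decode (pfst z)) (psnd z)))"
        and b = "\<lambda>z. pair (Suc 0) (psnd z)"] assms])
    (simp_all add: trm_code_pair env_def recur comp_def del: trm_code.simps)

lemma decid_is_term [recur]:
  assumes "finite_type L" "recursive f"
  shows "decid (\<lambda>x. is_term L (trm_of (f x)))"
proof (rule decid_trm_fold[where P = "\<lambda>_ t. is_term L t" and f = "\<lambda>_. 0"])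
  \<comment> \<open>Finite type turns the graph of \<open>L\<close> into a finite set of coded
    pairs.\<close>
  have sym: "decid (\<lambda>z. L (pfst z) = Some (psnd z))"
  proof -
    have "finite ((\<lambda>f. pair f (the (L f))) ` dom L)"
      using assms(1) by (simp add: finite_type_def)
    moreover have "z \<in> (\<lambda>f. pair f (the (L f))) ` dom L \<longleftrightarrow> L (pfst z) = Some (psnd z)" for z
    proof
      assume "L (pfst z) = Some (psnd z)"
      then show "z \<in> (\<lambda>f. pair f (the (L f))) ` dom L"
        by (intro image_eqI[of _ _ "pfst z"]) auto
    qed auto
    ultimately show ?thesis using decid_finite[of "(\<lambda>f. pair f (the (L f))) ` dom L"] by simp
  qed
  show "recursive (\<lambda>z. of_bool (is_term L (trm_of (psnd z))))"
    by (rule recursive_trm_fold[where f = "\<lambda>_ t. of_bool (is_term L t)" and a = "\<lambda>_. 1"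
        and b = "\<lambda>z. of_bool (L (pfst (psnd z)) = Some (llen (psnd (psnd z))) \<and>
            (\<forall>v\<in>set (list_decode (psnd (psnd z))). v = 1))"])
      (simp, force simp: of_bool_def, intro recur, intro recur decid_comp2[OF sym])
qed (intro recur assms(2))+

section \<open>Quotients of the term algebra and a refutation calculus\<close>

lemma eval_cong: "(\<And>n. n \<in> tvars t \<Longrightarrow> v n = w n) \<Longrightarrow> eval A v t = eval A w t"
proof (induction t)
  case (Fn f ts)
  have "map (eval A v) ts = map (eval A w) ts"
    by (rule map_cong[OF refl], rule Fn.IH) (use Fn.prems in auto)
  then show ?case by (simp only: eval.simps)
qed simp

lemma sat_cong: "(\<And>n. n \<in> fvars p \<Longrightarrow> v n = w n) \<Longrightarrow> sat A v p = sat A w p"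
proof (induction p arbitrary: v w)
  case (Eq t s)
  then have "eval A v t = eval A w t" "eval A v s = eval A w s" by (auto intro: eval_cong)
  then show ?case by simp
next
  case (Neg p)
  from Neg.IH[of v w] Neg.prems show ?case by simp
next
  case (Conj p q)
  from Conj.IH(1)[of v w] Conj.IH(2)[of v w] Conj.prems show ?case by simp
next
  case (Forall x p)
  have "sat A (v(x := a)) p = sat A (w(x := a)) p" for a
    by (rule Forall.IH) (use Forall.prems in auto)
  then show ?case by simp
qed

lemma eval_subst: "eval A v (subst \<sigma> t) = eval A (\<lambda>n. eval A v (\<sigma> n)) t"
proof (induction t)
  case (Fn f ts)
  then have "map (\<lambda>t. eval A v (subst \<sigma> t)) ts = map (eval A (\<lambda>n. eval A v (\<sigma> n))) ts" by simp
  then show ?case by (simp only: subst.simps eval.simps map_map comp_def)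
qed simp

lemma eval_in_carrier:
  "algebra L A \<Longrightarrow> range v \<subseteq> carrier A \<Longrightarrow> is_term L t \<Longrightarrow> eval A v t \<in> carrier A"
proof (induction t)
  case (Fn f ts)
  then have "set (map (eval A v) ts) \<subseteq> carrier A" by auto
  with Fn.prems show ?case unfolding algebra_def by simp
qed auto

lemma is_term_subst: "is_term L t \<Longrightarrow> (\<And>n. is_term L (\<sigma> n)) \<Longrightarrow> is_term L (subst \<sigma> t)"
  by (induction t) auto

section \<open>Congruences on terms and their quotients\<close>

definition term_cong :: "lang \<Rightarrow> (trm \<times> trm) set \<Rightarrow> bool" where
  "term_cong L \<Theta> \<longleftrightarrow> equiv {t. is_term L t} \<Theta> \<and>
    (\<forall>f ts ss. L f = Some (length ts) \<longrightarrow> list_all2 (\<lambda>t s. (t, s) \<in> \<Theta>) ts ss \<longrightarrow> (Fn f ts, Fn f ss) \<in> \<Theta>)"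

text \<open>The construction of \<open>free_alg\<close> for an arbitrary congruence, so that the
  free algebra and the term models of the completeness proof are treated alike.\<close>

definition quot_alg :: "lang \<Rightarrow> (trm \<times> trm) set \<Rightarrow> trm set alg" where
  "quot_alg L \<Theta> = \<lparr>carrier = {t. is_term L t} // \<Theta>,
     oper = (\<lambda>f cs. \<Theta> `` {Fn f ts |ts. list_all2 (\<in>) ts cs})\<rparr>"

text \<open>By congruence, all choices of representatives of the arguments yield terms of one class,
  so the union of their classes is that class.\<close>

lemma quot_alg_oper:
  assumes "term_cong L \<Theta>" "L f = Some (length ts)" "\<And>t. t \<in> set ts \<Longrightarrow> is_term L t"
  shows "oper (quot_alg L \<Theta>) f (map (\<lambda>t. \<Theta> `` {t}) ts) = \<Theta> `` {Fn f ts}"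
proof -
  have equiv: "equiv {t. is_term L t} \<Theta>" using assms(1) by (simp add: term_cong_def)
  have "{Fn f us |us. list_all2 (\<in>) us (map (\<lambda>t. \<Theta> `` {t}) ts)} \<subseteq> \<Theta> `` {Fn f ts}"
    using assms(1,2) by (auto simp: term_cong_def list_all2_map2 list_all2_conv_all_nth)
  moreover have "Fn f ts \<in> {Fn f us |us. list_all2 (\<in>) us (map (\<lambda>t. \<Theta> `` {t}) ts)}"
    using assms(3) equiv_class_self[OF equiv] by (auto simp: list_all2_conv_all_nth)
  ultimately have "\<Theta> `` {Fn f us |us. list_all2 (\<in>) us (map (\<lambda>t. \<Theta> `` {t}) ts)} = \<Theta> `` {Fn f ts}"
    using equiv by (auto elim!: equivE dest: transD)
  then show ?thesis by (simp add: quot_alg_def)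
qed

lemma algebra_quot_alg: assumes "term_cong L \<Theta>" shows "algebra L (quot_alg L \<Theta>)"
proof -
  have equiv: "equiv {t. is_term L t} \<Theta>" using assms by (simp add: term_cong_def)
  have "oper (quot_alg L \<Theta>) f cs \<in> carrier (quot_alg L \<Theta>)"
    if f: "L f = Some (length cs)" and cs: "set cs \<subseteq> carrier (quot_alg L \<Theta>)" for f cs
  proof -
    have "\<exists>ts. cs = map (\<lambda>t. \<Theta> `` {t}) ts \<and> (\<forall>t\<in>set ts. is_term L t)"
      using cs
    proof (induction cs)
      case (Cons c cs)
      then obtain ts where "cs = map (\<lambda>t. \<Theta> `` {t}) ts" "\<forall>t\<in>set ts. is_term L t" by auto
      moreover obtain t where "is_term L t" "c = \<Theta> `` {t}"
        using Cons.prems by (auto simp: quot_alg_def quotient_def)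
      ultimately show ?case by (intro exI[of _ "t # ts"]) simp
    qed simp
    then obtain ts where ts: "cs = map (\<lambda>t. \<Theta> `` {t}) ts" "\<forall>t\<in>set ts. is_term L t" by blast
    then have "oper (quot_alg L \<Theta>) f cs = \<Theta> `` {Fn f ts}"
      using quot_alg_oper[OF assms, of f ts] f by simp
    moreover have "is_term L (Fn f ts)" using ts f by simp
    ultimately show ?thesis by (simp add: quot_alg_def quotientI)
  qed
  moreover have "carrier (quot_alg L \<Theta>) \<noteq> {}"
    using quotientI[of "Var 0" "{t. is_term L t}" \<Theta>] by (auto simp: quot_alg_def simp del: quotient_is_empty)
  ultimately show ?thesis by (auto simp: algebra_def)
qed

lemma eval_quot_alg:
  assumes "term_cong L \<Theta>" "\<And>n. is_term L (\<sigma> n)" "is_term L t"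
  shows "eval (quot_alg L \<Theta>) (\<lambda>n. \<Theta> `` {\<sigma> n}) t = \<Theta> `` {subst \<sigma> t}"
  using assms(3)
proof (induction t)
  case (Fn f ts)
  then have "map (eval (quot_alg L \<Theta>) (\<lambda>n. \<Theta> `` {\<sigma> n})) ts = map (\<lambda>t. \<Theta> `` {t}) (map (subst \<sigma>) ts)"
    by auto
  moreover have "oper (quot_alg L \<Theta>) f (map (\<lambda>t. \<Theta> `` {t}) (map (subst \<sigma>) ts)) =
      \<Theta> `` {Fn f (map (subst \<sigma>) ts)}"
    by (rule quot_alg_oper[OF assms(1)]) (use Fn.prems assms(2) in \<open>auto intro: is_term_subst\<close>)
  ultimately show ?case by (simp only: eval.simps subst.simps)
qed simp

lemma valuation_quot_algE:
  assumes "range v \<subseteq> carrier (quot_alg L \<Theta>)"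
  obtains \<sigma> where "\<And>n. is_term L (\<sigma> n)" "v = (\<lambda>n. \<Theta> `` {\<sigma> n})"
proof -
  have "\<forall>n. \<exists>t. is_term L t \<and> v n = \<Theta> `` {t}"
    using assms by (auto simp: quot_alg_def quotient_def)
  then obtain \<sigma> where "\<forall>n. is_term L (\<sigma> n) \<and> v n = \<Theta> `` {\<sigma> n}" by metis
  then show ?thesis by (intro that[of \<sigma>]) auto
qed

section \<open>A refutation calculus and its soundness\<close>

definition fn_code :: "nat \<Rightarrow> nat \<Rightarrow> nat" where "fn_code f ts = pair (Suc 0) (pair f ts)"
definition eq_code :: "nat \<Rightarrow> nat \<Rightarrow> nat" where "eq_code t s = pair 0 (pair t s)"
definition neg_code :: "nat \<Rightarrow> nat" where "neg_code p = pair (Suc 0) p"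
definition conj_code :: "nat \<Rightarrow> nat \<Rightarrow> nat" where "conj_code p q = pair 2 (pair p q)"
definition all_code :: "nat \<Rightarrow> nat \<Rightarrow> nat" where "all_code x p = pair 3 (pair x p)"

lemmas code_defs = fn_code_def eq_code_def neg_code_def conj_code_def all_code_def

text \<open>The substitution of an item is evaluated to a valuation instead of being carried out in
  the formula, so no bound variable can capture anything.\<close>

definition holds :: "'a alg \<Rightarrow> (nat \<Rightarrow> 'a) \<Rightarrow> nat \<Rightarrow> bool" where
  "holds A v i \<longleftrightarrow> sat A (\<lambda>n. eval A v (env (psnd i) n)) (fm_of (pfst i))"

text \<open>A sequent is a finite list of items; the item \<open>pair p e\<close> asserts the formula with code \<open>p\<close>
  under the substitution with code \<open>e\<close>. Keeping formulas and substitutions apart avoids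
  substituting below quantifiers. In \<open>witness\<close>, \<open>y\<close> is fresh because no variable exceeds the
  code of an expression in which it occurs.\<close>

inductive refutable :: "lang \<Rightarrow> fm set \<Rightarrow> nat list \<Rightarrow> bool" for L S where
  contra: "refutable L S [pair p e, pair (neg_code p) e]"
| conj1: "refutable L S [pair (conj_code p q) e, pair (neg_code p) e]"
| conj2: "refutable L S [pair (conj_code p q) e, pair (neg_code q) e]"
| conj3: "refutable L S [pair (neg_code (conj_code p q)) e, pair p e, pair q e]"
| all: "is_term L (trm_of t) \<Longrightarrow> refutable L S [pair (all_code x p) e, pair (neg_code p) (lcons (pair x t) e)]"
| axiom: "p \<in> fm_code ` S \<Longrightarrow> refutable L S [pair (neg_code p) e]"
| refl: "refutable L S [pair (neg_code (eq_code t t)) 0]"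
| euclid: "refutable L S [pair (eq_code r s) 0, pair (eq_code r t) 0, pair (neg_code (eq_code s t)) 0]"
| cong: "llen ts = llen ss \<Longrightarrow> refutable L S (pair (neg_code (eq_code (fn_code f ts) (fn_code f ss))) 0 #
    map (\<lambda>i. pair (eq_code (lnth ts i) (lnth ss i)) 0) [0..<llen ts])"
| inst1: "refutable L S [pair (eq_code t s) e,
    pair (neg_code (eq_code (trm_code (subst (env e) (trm_of t))) (trm_code (subst (env e) (trm_of s))))) 0]"
| inst2: "refutable L S [pair (neg_code (eq_code t s)) e,
    pair (eq_code (trm_code (subst (env e) (trm_of t))) (trm_code (subst (env e) (trm_of s)))) 0]"
| weaken: "refutable L S \<Gamma> \<Longrightarrow> set \<Gamma> \<subseteq> set \<Delta> \<Longrightarrow> refutable L S \<Delta>"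
| cut: "refutable L S (pair p e # \<Gamma>) \<Longrightarrow> refutable L S (pair (neg_code p) e # \<Gamma>) \<Longrightarrow> refutable L S \<Gamma>"
| witness: "refutable L S (pair (neg_code p) (lcons (pair x (pair 0 y)) e) # pair (neg_code (all_code x p)) e # \<Gamma>) \<Longrightarrow>
    list_encode (pair (neg_code (all_code x p)) e # \<Gamma>) < y \<Longrightarrow> refutable L S (pair (neg_code (all_code x p)) e # \<Gamma>)"

text \<open>A listed variable is mapped to a term whose code is part of \<open>e\<close>, any other
  variable to itself.\<close>

lemma tvars_env_le: "m \<in> tvars (env e n) \<Longrightarrow> m \<le> e \<or> m = n"
proof -
  assume m: "m \<in> tvars (env e n)"
  from lookup_cases[of "list_decode e" n] consider "lookup (list_decode e) n = pair 0 n"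
    | d where "d \<in> set (list_decode e)" "lookup (list_decode e) n = psnd d" by blast
  then show ?thesis
  proof cases
    case 1
    with m show ?thesis by (simp add: env_def)
  next
    case 2
    then show ?thesis
      using m tvars_trm_of_le[of m "psnd d"] psnd_le[of d] member_list_decode_less[of d e]
      by (simp add: env_def)
  qed
qed

lemma holds_update: assumes "i < y" shows "holds A (v(y := a)) i = holds A v i"
  unfolding holds_def
proof (rule sat_cong, rule eval_cong)
  fix n m assume "n \<in> fvars (fm_of (pfst i))" "m \<in> tvars (env (psnd i) n)"
  then have "m \<le> i"
    using fvars_fm_of_le[of n "pfst i"] tvars_env_le[of m "psnd i" n] pfst_le[of i] psnd_le[of i] by auto
  then show "(v(y := a)) m = v m" using assms by simp
qed

lemma holds_simps:
  "holds A v (pair (neg_code p) e) \<longleftrightarrow> \<not> holds A v (pair p e)"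
  "holds A v (pair (conj_code p q) e) \<longleftrightarrow> holds A v (pair p e) \<and> holds A v (pair q e)"
  "holds A v (pair (eq_code t s) e) \<longleftrightarrow>
     eval A v (subst (env e) (trm_of t)) = eval A v (subst (env e) (trm_of s))"
  by (simp_all add: holds_def code_defs eval_subst)

lemma subst_Var [simp]: "subst Var t = t"
  by (induction t) (simp_all add: map_idI)

lemma holds_lcons:
  "holds A v (pair p (lcons (pair x t) e)) \<longleftrightarrow>
    sat A ((\<lambda>n. eval A v (env e n))(x := eval A v (trm_of t))) (fm_of p)"
proof -
  have "(\<lambda>n. eval A v (env (lcons (pair x t) e) n)) = (\<lambda>n. eval A v (env e n))(x := eval A v (trm_of t))"
    by auto
  then show ?thesis by (simp add: holds_def)
qed

lemma refutable_sound:
  assumes "A \<in> Mod L S" "S \<subseteq> sentences L" "refutable L S \<Gamma>" "range v \<subseteq> carrier A"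
  shows "\<exists>i\<in>set \<Gamma>. \<not> holds A v i"
  using assms(3,4)
\<comment> \<open>The valuation is generalized because \<open>witness\<close> changes it at the
  fresh variable.\<close>
proof (induction arbitrary: v rule: refutable.induct)
  case (all t x p e)
  then have "eval A v (trm_of t) \<in> carrier A"
    using assms(1) eval_in_carrier by (auto simp: Mod_def)
  then show ?case
    by (auto simp: holds_lcons) (simp add: holds_def all_code_def neg_code_def)
next
  case (axiom p e)
  then obtain s where s: "s \<in> S" "p = fm_code s" by blast
  have "valid A s" "fvars s = {}"
    using s assms(1,2) by (auto simp: Mod_def sentences_def)
  then have "sat A v s" "\<And>w. sat A w s = sat A v s"
    using axiom.prems sat_cong[of s _ v A] by (auto simp: valid_def)
  then show ?case by (simp add: s holds_def neg_code_def)
next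
  case (cong ts ss f)
  show ?case
  proof (rule ccontr)
    assume *: "\<not> ?thesis"
    then have "\<forall>i<llen ts. eval A v (trm_of (lnth ts i)) = eval A v (trm_of (lnth ss i))"
      by (auto simp: holds_simps)
    then have "map (\<lambda>t. eval A v (trm_of t)) (list_decode ts) = map (\<lambda>t. eval A v (trm_of t)) (list_decode ss)"
      using cong.hyps by (auto simp: list_eq_iff_nth_eq llen_def)
    with * show False by (auto simp: holds_simps fn_code_def comp_def)
  qed
next
  case (cut p e \<Gamma>)
  show ?case using cut.IH[OF cut.prems] by (auto simp: holds_simps)
next
  case (weaken \<Gamma> \<Delta>)
  then show ?case by blast
next
  case (witness p x y e \<Gamma>)
  show ?case
  proof (rule ccontr)
    assume "\<not> ?thesis"
    then have *: "\<And>i. i \<in> set (pair (neg_code (all_code x p)) e # \<Gamma>) \<Longrightarrow> holds A v i" by blast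
    then have "\<not> holds A v (pair (all_code x p) e)" using *[of "pair (neg_code (all_code x p)) e"] by (simp add: holds_simps)
    then obtain a where a: "a \<in> carrier A" "\<not> sat A ((\<lambda>n. eval A v (env e n))(x := a)) (fm_of p)"
      by (auto simp: holds_def all_code_def)
    \<comment> \<open>The fresh variable \<open>y\<close> is made to name a counterexample
      \<open>a\<close> to the quantified formula. The items of the sequent do not notice the change,
      so the premise can only fail at the new item; this contradicts the choice of
      \<open>a\<close>.\<close>
    let ?v = "v(y := a)"
    have less: "i < y" if "i \<in> set (pair (neg_code (all_code x p)) e # \<Gamma>)" for i
      using member_list_encode_less[OF that] witness.hyps(2) by simp
    have "range ?v \<subseteq> carrier A" using witness.prems a by auto
    from witness.IH[OF this] obtain i where i: "\<not> holds A ?v i"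
      "i = pair (neg_code p) (lcons (pair x (pair 0 y)) e) \<or> i \<in> set (pair (neg_code (all_code x p)) e # \<Gamma>)"
      by (metis set_ConsD)
    have "\<not> i \<in> set (pair (neg_code (all_code x p)) e # \<Gamma>)"
      using i(1) * less holds_update by metis
    with i have "\<not> holds A ?v (pair (neg_code p) (lcons (pair x (pair 0 y)) e))" by blast
    then have "sat A ((\<lambda>n. eval A ?v (env e n))(x := a)) (fm_of p)"
      by (simp add: holds_lcons neg_code_def)
    moreover have "sat A ((\<lambda>n. eval A ?v (env e n))(x := a)) (fm_of p) =
        sat A ((\<lambda>n. eval A v (env e n))(x := a)) (fm_of p)"
    proof (rule sat_cong)
      fix n assume "n \<in> fvars (fm_of p)"
      have "pair (neg_code (all_code x p)) e < y" using less by simp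
      moreover have "p \<le> pair (neg_code (all_code x p)) e" "e \<le> pair (neg_code (all_code x p)) e"
        unfolding neg_code_def all_code_def using pair_ge by (meson le_trans)+
      ultimately have "n < y" "e < y" using fvars_fm_of_le[OF \<open>n \<in> fvars (fm_of p)\<close>] by simp_all
      then have "eval A ?v (env e n) = eval A v (env e n)"
        using tvars_env_le[of _ e n] by (intro eval_cong) fastforce
      then show "((\<lambda>n. eval A ?v (env e n))(x := a)) n = ((\<lambda>n. eval A v (env e n))(x := a)) n" by simp
    qed
    ultimately show False using a by simp
  qed
qed (auto simp: holds_simps)

section \<open>Completeness and semidecidability of the calculus\<close>

text \<open>One step of a Lindenbaum-Henkin construction: \<open>k\<close> is added if the sequent
  stays irrefutable, and a negated universal item is accompanied by an instance at a fresh
  variable.\<close>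

lemma extend_sequent:
  assumes "\<not> refutable L S \<Gamma>"
  shows "\<exists>\<Delta>. \<not> refutable L S \<Delta> \<and> set \<Gamma> \<subseteq> set \<Delta> \<and> (k \<in> set \<Delta> \<or> refutable L S (k # \<Gamma>)) \<and>
    (\<forall>x p e. k = pair (neg_code (all_code x p)) e \<and> k \<in> set \<Delta> \<longrightarrow>
      (\<exists>y. pair (neg_code p) (lcons (pair x (pair 0 y)) e) \<in> set \<Delta>))"
proof (cases "refutable L S (k # \<Gamma>)")
  case True
  have "k \<notin> set \<Gamma>" using assms True weaken[OF True, of \<Gamma>] by auto
  with True assms show ?thesis by (intro exI[of _ \<Gamma>]) auto
next
  case False
  show ?thesis
  proof (cases "\<exists>x p e. k = pair (neg_code (all_code x p)) e")
    case True
    then obtain x p e where k: "k = pair (neg_code (all_code x p)) e" by blast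
    \<comment> \<open>The successor of the code of the sequent meets the freshness condition of
      \<open>witness\<close>.\<close>
    let ?i = "pair (neg_code p) (lcons (pair x (pair 0 (Suc (list_encode (k # \<Gamma>))))) e)"
    have "\<not> refutable L S (?i # k # \<Gamma>)"
      using False refutable.witness[where \<Gamma> = \<Gamma> and p = p and x = x and e = e
          and y = "Suc (list_encode (k # \<Gamma>))" and L = L and S = S]
      unfolding k by blast
    then show ?thesis
      by (intro exI[of _ "?i # k # \<Gamma>"]) (auto simp: k code_defs)
  qed (use False in \<open>auto intro!: exI[of _ "k # \<Gamma>"]\<close>)
qed

text \<open>Every number is an item, so stage \<open>k\<close> can treat the item \<open>k\<close>,
  and the union of the stages decides all items. The union stays consistent because a refutable
  sequent is finite and would lie within one stage.\<close>

lemma maximal_consistent: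
  assumes "\<not> refutable L S \<Gamma>"
  obtains M where "set \<Gamma> \<subseteq> M"
    and "\<And>\<Delta>. set \<Delta> \<subseteq> M \<Longrightarrow> \<not> refutable L S \<Delta>"
    and "\<And>p e. pair p e \<in> M \<or> pair (neg_code p) e \<in> M"
    and "\<And>x p e. pair (neg_code (all_code x p)) e \<in> M \<Longrightarrow>
      \<exists>y. pair (neg_code p) (lcons (pair x (pair 0 y)) e) \<in> M"
proof -
  let ?Q = "\<lambda>k \<Gamma> \<Delta>. set \<Gamma> \<subseteq> set \<Delta> \<and> (k \<in> set \<Delta> \<or> refutable L S (k # \<Gamma>)) \<and>
    (\<forall>x p e. k = pair (neg_code (all_code x p)) e \<and> k \<in> set \<Delta> \<longrightarrow>
      (\<exists>y. pair (neg_code p) (lcons (pair x (pair 0 y)) e) \<in> set \<Delta>))"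
  have "\<exists>C. \<forall>k. (\<not> refutable L S (C k) \<and> (k = 0 \<longrightarrow> C k = \<Gamma>)) \<and> ?Q k (C k) (C (Suc k))"
  proof (rule dependent_nat_choice)
    show "\<exists>\<Delta>. \<not> refutable L S \<Delta> \<and> (0 = 0 \<longrightarrow> \<Delta> = \<Gamma>)" using assms by blast
    show "\<exists>\<Delta>'. (\<not> refutable L S \<Delta>' \<and> (Suc k = 0 \<longrightarrow> \<Delta>' = \<Gamma>)) \<and> ?Q k \<Delta> \<Delta>'"
      if "\<not> refutable L S \<Delta> \<and> (k = 0 \<longrightarrow> \<Delta> = \<Gamma>)" for \<Delta> k
      using extend_sequent[of L S \<Delta> k] that by blast
  qed
  then obtain C where C: "\<forall>k. (\<not> refutable L S (C k) \<and> (k = 0 \<longrightarrow> C k = \<Gamma>)) \<and> ?Q k (C k) (C (Suc k))"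
    by (elim exE)
  have cons: "\<not> refutable L S (C k)" for k by (rule spec[OF C, THEN conjunct1, THEN conjunct1])
  have Q: "?Q k (C k) (C (Suc k))" for k by (rule spec[OF C, THEN conjunct2])
  have C0: "C 0 = \<Gamma>" using spec[OF C, of 0] by simp
  have mono: "set (C k) \<subseteq> set (C m)" if "k \<le> m" for k m
    using that by (rule lift_Suc_mono_le[where f = "\<lambda>k. set (C k)", rotated]) (use Q in blast)
  let ?M = "\<Union>k. set (C k)"
  have fin: "\<exists>k. set \<Delta> \<subseteq> set (C k)" if "set \<Delta> \<subseteq> ?M" for \<Delta>
    using that
  proof (induction \<Delta>)
    case (Cons i \<Delta>)
    then obtain k m where "set \<Delta> \<subseteq> set (C k)" "i \<in> set (C m)" by auto
    then show ?case using mono[of k "max k m"] mono[of m "max k m"]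
      by (intro exI[of _ "max k m"]) auto
  qed simp
  show ?thesis
  proof (rule that[of ?M])
    show "set \<Gamma> \<subseteq> ?M" using C0 by auto
    show "\<not> refutable L S \<Delta>" if "set \<Delta> \<subseteq> ?M" for \<Delta>
      using fin[OF that] cons weaken by metis
    show "pair p e \<in> ?M \<or> pair (neg_code p) e \<in> ?M" for p e
    proof (rule ccontr)
      assume "\<not> ?thesis"
      then have r: "refutable L S (pair p e # C (pair p e))"
        "refutable L S (pair (neg_code p) e # C (pair (neg_code p) e))"
        using Q[of "pair p e"] Q[of "pair (neg_code p) e"] by blast+
      \<comment> \<open>Each of the two items was rejected at its own stage. Weakening moves both
        refutations to a common later stage, where \<open>cut\<close> refutes that stage.\<close>
      define m where "m = max (pair p e) (pair (neg_code p) e)"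
      have "set (C (pair p e)) \<subseteq> set (C m)" "set (C (pair (neg_code p) e)) \<subseteq> set (C m)"
        by (simp_all add: m_def mono)
      then have "refutable L S (pair p e # C m)" "refutable L S (pair (neg_code p) e # C m)"
        by - (rule weaken[OF r(1)], force, rule weaken[OF r(2)], force)
      then have "refutable L S (C m)" by (rule cut)
      with cons show False by blast
    qed
    show "\<exists>y. pair (neg_code p) (lcons (pair x (pair 0 y)) e) \<in> ?M"
      if "pair (neg_code (all_code x p)) e \<in> ?M" for x p e
    proof -
      let ?k = "pair (neg_code (all_code x p)) e"
      obtain m where "?k \<in> set (C m)" using \<open>?k \<in> ?M\<close> by blast
      define n where "n = max m ?k"
      \<comment> \<open>The witness is supplied at the stage numbered \<open>?k\<close>, while
        \<open>?k\<close> may have entered at another stage \<open>m\<close>. Had its own stage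
        rejected it, the later stage \<open>n\<close>, which contains \<open>?k\<close>, would be
        refutable.\<close>
      have "?k \<in> set (C (Suc ?k))"
      proof (rule ccontr)
        assume "?k \<notin> set (C (Suc ?k))"
        then have "refutable L S (?k # C ?k)" using Q[of ?k] by blast
        then have "refutable L S (C n)"
          by (rule weaken) (use mono[of m n] mono[of ?k n] \<open>?k \<in> set (C m)\<close> in \<open>auto simp: n_def\<close>)
        with cons show False by blast
      qed
      then show ?thesis using Q[of ?k] by blast
    qed
  qed
qed

text \<open>Henkin's model: all terms modulo the equations in a maximal irrefutable set
  \<open>M\<close>. Equations between the terms themselves are the items whose substitution is 0,
  the code of the identity.\<close>

lemma refutable_complete:
  assumes S: "S \<subseteq> sentences L" and p: "is_fm L p"
    and "\<not> refutable L S [pair (neg_code (fm_code p)) 0]"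
  obtains \<Theta> where "term_cong L \<Theta>" "quot_alg L \<Theta> \<in> Mod L S" "\<not> valid (quot_alg L \<Theta>) p"
proof -
  obtain M where M0: "set [pair (neg_code (fm_code p)) 0] \<subseteq> M"
    and cons: "\<And>\<Delta>. set \<Delta> \<subseteq> M \<Longrightarrow> \<not> refutable L S \<Delta>"
    and max: "\<And>p e. pair p e \<in> M \<or> pair (neg_code p) e \<in> M"
    and wit: "\<And>x p e. pair (neg_code (all_code x p)) e \<in> M \<Longrightarrow>
      \<exists>y. pair (neg_code p) (lcons (pair x (pair 0 y)) e) \<in> M"
    by (fact maximal_consistent[OF assms(3)])
  \<comment> \<open>\<open>M\<close> is closed under the rules: were \<open>pair p e\<close>
    missing, its negation would belong to \<open>M\<close>, and the refutable sequent would be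
    contained in \<open>M\<close>.\<close>
  have ded: "pair p e \<in> M" if "refutable L S \<Delta>" "set \<Delta> \<subseteq> insert (pair (neg_code p) e) M" for p e \<Delta>
    using that cons[of \<Delta>] max[of p e] by blast
  have neg: "pair (neg_code p) e \<in> M \<longleftrightarrow> pair p e \<notin> M" for p e
    using max[of p e] cons[of "[pair p e, pair (neg_code p) e]"] contra[of L S p e] by auto
  define \<Theta> where "\<Theta> = {(t, s). is_term L t \<and> is_term L s \<and> pair (eq_code (trm_code t) (trm_code s)) 0 \<in> M}"
  have refl: "pair (eq_code t t) 0 \<in> M" for t
    by (rule ded[OF refutable.refl[of L S t]]) simp
  have euclid: "pair (eq_code s t) 0 \<in> M" if "pair (eq_code r s) 0 \<in> M" "pair (eq_code r t) 0 \<in> M" for r s t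
    by (rule ded[OF refutable.euclid[of L S r s t]]) (use that in simp)
  have sym: "pair (eq_code t s) 0 \<in> M" if "pair (eq_code s t) 0 \<in> M" for s t
    using euclid[OF that refl] .
  have equiv: "equiv {t. is_term L t} \<Theta>"
  proof (rule equivI)
    show "\<Theta> \<subseteq> {t. is_term L t} \<times> {t. is_term L t}" "refl_on {t. is_term L t} \<Theta>"
      by (auto simp: \<Theta>_def refl refl_on_def)
    show "sym \<Theta>" by (auto simp: \<Theta>_def sym_def intro: sym)
    show "trans \<Theta>" by (auto simp: \<Theta>_def trans_def intro: euclid[OF sym])
  qed
  have "(Fn f ts, Fn f ss) \<in> \<Theta>"
    if f: "L f = Some (length ts)" and \<Theta>: "list_all2 (\<lambda>t s. (t, s) \<in> \<Theta>) ts ss" for f ts ss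
  proof -
    let ?ts = "list_encode (map trm_code ts)" and ?ss = "list_encode (map trm_code ss)"
    have len: "length ss = length ts" using \<Theta> by (simp add: list_all2_lengthD)
    have nth: "(ts ! i, ss ! i) \<in> \<Theta>" if "i < length ts" for i
      using list_all2_nthD[OF \<Theta> that] .
    have "pair (eq_code (fn_code f ?ts) (fn_code f ?ss)) 0 \<in> M"
    proof (rule ded[OF refutable.cong])
      show "set (pair (neg_code (eq_code (fn_code f ?ts) (fn_code f ?ss))) 0 #
          map (\<lambda>i. pair (eq_code (lnth ?ts i) (lnth ?ss i)) 0) [0..<llen ?ts])
        \<subseteq> insert (pair (neg_code (eq_code (fn_code f ?ts) (fn_code f ?ss))) 0) M"
        using nth len by (auto simp: \<Theta>_def)
    qed (simp add: len)
    moreover have "is_term L (Fn f ts)" "is_term L (Fn f ss)"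
      using f len nth by (auto simp: \<Theta>_def in_set_conv_nth)
    ultimately show ?thesis by (simp add: \<Theta>_def trm_code_pair fn_code_def del: trm_code.simps)
  qed
  with equiv have cong: "term_cong L \<Theta>" by (simp add: term_cong_def)
  let ?D = "quot_alg L \<Theta>"
  \<comment> \<open>The truth lemma is proved for all substitutions \<open>e\<close>, since the
    quantifier case extends \<open>e\<close> by the term that represents an element.\<close>
  have truth: "sat ?D (\<lambda>n. \<Theta> `` {env e n}) p \<longleftrightarrow> pair (fm_code p) e \<in> M"
    if "is_fm L p" "\<And>n. is_term L (env e n)" for p e
    using that
  proof (induction p arbitrary: e)
    case (Eq t s)
    let ?t = "subst (env e) t" and ?s = "subst (env e) s"
    have terms: "is_term L ?t" "is_term L ?s" using Eq by (auto intro: is_term_subst)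
    have "eval ?D (\<lambda>n. \<Theta> `` {env e n}) t = \<Theta> `` {?t}" "eval ?D (\<lambda>n. \<Theta> `` {env e n}) s = \<Theta> `` {?s}"
      by (rule eval_quot_alg[OF cong]; use Eq in simp)+
    then have "sat ?D (\<lambda>n. \<Theta> `` {env e n}) (Eq t s) \<longleftrightarrow> \<Theta> `` {?t} = \<Theta> `` {?s}" by simp
    also have "\<dots> \<longleftrightarrow> (?t, ?s) \<in> \<Theta>" using eq_equiv_class_iff[OF equiv, of ?t ?s] terms by simp
    also have "\<dots> \<longleftrightarrow> pair (eq_code (trm_code ?t) (trm_code ?s)) 0 \<in> M"
      using terms by (simp add: \<Theta>_def)
    \<comment> \<open>The rules \<open>inst1\<close> and \<open>inst2\<close> exchange an equation
      under \<open>e\<close> for the substituted equation under the identity.\<close>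
    also have "\<dots> \<longleftrightarrow> pair (eq_code (trm_code t) (trm_code s)) e \<in> M"
    proof
      assume "pair (eq_code (trm_code ?t) (trm_code ?s)) 0 \<in> M"
      then show "pair (eq_code (trm_code t) (trm_code s)) e \<in> M"
        by (intro ded[OF inst2[of L S "trm_code t" "trm_code s" e]]) simp
    next
      assume "pair (eq_code (trm_code t) (trm_code s)) e \<in> M"
      then show "pair (eq_code (trm_code ?t) (trm_code ?s)) 0 \<in> M"
        by (intro ded[OF inst1[of L S "trm_code t" "trm_code s" e]]) simp
    qed
    finally show ?case by (simp add: fm_code_pair eq_code_def del: fm_code.simps)
  next
    case (Neg p)
    then show ?case using neg[of "fm_code p" e] by (simp add: fm_code_pair neg_code_def del: fm_code.simps)
  next
    case (Conj p q)
    let ?p = "fm_code p" and ?q = "fm_code q"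
    have "pair (conj_code ?p ?q) e \<in> M \<longleftrightarrow> pair ?p e \<in> M \<and> pair ?q e \<in> M"
    proof
      assume "pair (conj_code ?p ?q) e \<in> M"
      then show "pair ?p e \<in> M \<and> pair ?q e \<in> M"
        by (intro conjI ded[OF conj1[of L S ?p ?q e]] ded[OF conj2[of L S ?p ?q e]]) simp_all
    next
      assume "pair ?p e \<in> M \<and> pair ?q e \<in> M"
      then show "pair (conj_code ?p ?q) e \<in> M" by (intro ded[OF conj3[of L S ?p ?q e]]) simp
    qed
    then show ?case using Conj by (simp add: fm_code_pair conj_code_def del: fm_code.simps)
  next
    case (Forall x p)
    have inst: "sat ?D ((\<lambda>n. \<Theta> `` {env e n})(x := \<Theta> `` {t})) p \<longleftrightarrow>
        pair (fm_code p) (lcons (pair x (trm_code t)) e) \<in> M" if "is_term L t" for t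
    proof -
      have "(\<lambda>n. \<Theta> `` {env (lcons (pair x (trm_code t)) e) n}) = (\<lambda>n. \<Theta> `` {env e n})(x := \<Theta> `` {t})"
        by (rule ext) simp
      then show ?thesis
        using Forall.IH[of "lcons (pair x (trm_code t)) e"] Forall.prems that by simp
    qed
    have "pair (all_code x (fm_code p)) e \<in> M \<longleftrightarrow>
      (\<forall>t. is_term L t \<longrightarrow> pair (fm_code p) (lcons (pair x (trm_code t)) e) \<in> M)"
    proof
      assume *: "pair (all_code x (fm_code p)) e \<in> M"
      show "\<forall>t. is_term L t \<longrightarrow> pair (fm_code p) (lcons (pair x (trm_code t)) e) \<in> M"
      proof (intro allI impI)
        fix t assume "is_term L t"
        then show "pair (fm_code p) (lcons (pair x (trm_code t)) e) \<in> M"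
          by (intro ded[OF refutable.all[of L "trm_code t" S x "fm_code p" e]]) (use * in simp_all)
      qed
    next
      assume *: "\<forall>t. is_term L t \<longrightarrow> pair (fm_code p) (lcons (pair x (trm_code t)) e) \<in> M"
      show "pair (all_code x (fm_code p)) e \<in> M"
      proof (rule ccontr)
        assume "pair (all_code x (fm_code p)) e \<notin> M"
        \<comment> \<open>The negation of a missing universal formula lies in \<open>M\<close>, and
          its Henkin witness \<open>Var y\<close> contradicts \<open>*\<close>.\<close>
        then obtain y where "pair (neg_code (fm_code p)) (lcons (pair x (pair 0 y)) e) \<in> M"
          using neg wit by blast
        with neg *[rule_format, of "Var y"] show False
          by (simp add: trm_code_pair del: trm_code.simps)
      qed
    qed
    also have "\<dots> \<longleftrightarrow> (\<forall>a\<in>carrier ?D. sat ?D ((\<lambda>n. \<Theta> `` {env e n})(x := a)) p)"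
      using inst by (auto simp: quot_alg_def quotient_def)
    finally show ?case by (simp add: fm_code_pair all_code_def del: fm_code.simps)
  qed
  have Var: "sat ?D (\<lambda>n. \<Theta> `` {Var n}) q \<longleftrightarrow> pair (fm_code q) 0 \<in> M" if "is_fm L q" for q
    using truth[of q 0] that by simp
  have Var_carrier: "range (\<lambda>n. \<Theta> `` {Var n}) \<subseteq> carrier ?D"
    by (auto simp: quot_alg_def intro: quotientI)
  show ?thesis
  proof (rule that[OF cong])
    have "valid ?D q" if "q \<in> S" for q
    proof -
      have q: "is_fm L q" "fvars q = {}" using that S by (auto simp: sentences_def)
      have "pair (fm_code q) 0 \<in> M" by (rule ded[OF axiom]) (use that in auto)
      then have "sat ?D (\<lambda>n. \<Theta> `` {Var n}) q" using Var q by simp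
      moreover have "sat ?D w q = sat ?D (\<lambda>n. \<Theta> `` {Var n}) q" for w
        by (rule sat_cong) (simp add: q(2))
      ultimately show ?thesis by (simp add: valid_def)
    qed
    with algebra_quot_alg[OF cong] show "?D \<in> Mod L S" by (auto simp: Mod_def)
    have "\<not> sat ?D (\<lambda>n. \<Theta> `` {Var n}) p" using Var[OF p] neg M0 by simp
    with Var_carrier show "\<not> valid ?D p" by (auto simp: valid_def)
  qed
qed

section \<open>Enumerating the refutations\<close>

text \<open>The rules of \<open>refutable\<close> on codes, in the same order; rules without
  premises have the empty list 0 as \<open>ps\<close>. Each disjunct is an existential statement
  with a decidable matrix once \<open>S\<close> is decidable and \<open>L\<close> has finite
  type.\<close>

definition refutable_rule :: "lang \<Rightarrow> fm set \<Rightarrow> nat \<Rightarrow> nat \<Rightarrow> bool" where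
  "refutable_rule L S ps c \<longleftrightarrow>
    (\<exists>p e. ps = 0 \<and> c = lcons (pair p e) (lcons (pair (neg_code p) e) 0)) \<or>
    (\<exists>p q e. ps = 0 \<and> c = lcons (pair (conj_code p q) e) (lcons (pair (neg_code p) e) 0)) \<or>
    (\<exists>p q e. ps = 0 \<and> c = lcons (pair (conj_code p q) e) (lcons (pair (neg_code q) e) 0)) \<or>
    (\<exists>p q e. ps = 0 \<and>
      c = lcons (pair (neg_code (conj_code p q)) e) (lcons (pair p e) (lcons (pair q e) 0))) \<or>
    (\<exists>t x p e. ps = 0 \<and> is_term L (trm_of t) \<and>
      c = lcons (pair (all_code x p) e) (lcons (pair (neg_code p) (lcons (pair x t) e)) 0)) \<or>
    (\<exists>p e. ps = 0 \<and> p \<in> fm_code ` S \<and> c = lcons (pair (neg_code p) e) 0) \<or>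
    (\<exists>t. ps = 0 \<and> c = lcons (pair (neg_code (eq_code t t)) 0) 0) \<or>
    (\<exists>r s t. ps = 0 \<and> c = lcons (pair (eq_code r s) 0)
      (lcons (pair (eq_code r t) 0) (lcons (pair (neg_code (eq_code s t)) 0) 0))) \<or>
    (\<exists>f ts ss. ps = 0 \<and> llen ts = llen ss \<and> c = lcons (pair (neg_code (eq_code (fn_code f ts) (fn_code f ss))) 0)
      (ltab (\<lambda>i. pair (eq_code (lnth ts i) (lnth ss i)) 0) (llen ts))) \<or>
    (\<exists>t s e. ps = 0 \<and> c = lcons (pair (eq_code t s) e) (lcons (pair (neg_code (eq_code
      (trm_code (subst (env e) (trm_of t))) (trm_code (subst (env e) (trm_of s))))) 0) 0)) \<or>
    (\<exists>t s e. ps = 0 \<and> c = lcons (pair (neg_code (eq_code t s)) e) (lcons (pair (eq_code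
      (trm_code (subst (env e) (trm_of t))) (trm_code (subst (env e) (trm_of s)))) 0) 0)) \<or>
    (\<exists>d. ps = lcons d 0 \<and> (\<forall>i\<in>set (list_decode d). i \<in> set (list_decode c))) \<or>
    (\<exists>p e. ps = lcons (lcons (pair p e) c) (lcons (lcons (pair (neg_code p) e) c) 0)) \<or>
    (\<exists>p x y e d. c = lcons (pair (neg_code (all_code x p)) e) d \<and> c < y \<and>
      ps = lcons (lcons (pair (neg_code p) (lcons (pair x (pair 0 y)) e)) c) 0)"

lemma semidecid_refutable_rule:
  assumes "finite_type L" "decidable S"
  shows "semidecid (\<lambda>z. refutable_rule L S (pfst z) (psnd z))"
proof -
  have [recur]: "decid (\<lambda>x. f x \<in> fm_code ` S)" if "recursive f" for f
    using decid_comp[OF _ that, of "\<lambda>x. x \<in> fm_code ` S"] assms(2)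
    by (simp add: decidable_def recursive_set_iff_decid)
  note decid_is_term[OF assms(1), recur]
  show ?thesis
    unfolding refutable_rule_def code_defs
    by (intro semidecid_disj semidecid_ex semidecid_decid; intro recur)
qed

lemma refutable_iff_rule_closure:
  "refutable L S (list_decode c) \<longleftrightarrow> rule_closure (refutable_rule L S) c"
proof
  have ax: "refutable_rule L S 0 c \<Longrightarrow> rule_closure (refutable_rule L S) c" for c
    by (rule rule_closure.intros[of _ 0]) simp_all
  have "rule_closure (refutable_rule L S) (list_encode \<Gamma>)" if "refutable L S \<Gamma>" for \<Gamma>
    using that
  proof induction
    case (cong ts ss f)
    then show ?case
      unfolding list_encode_Cons by (intro ax) (unfold refutable_rule_def ltab_def, blast)
  next
    case (weaken \<Gamma> \<Delta>)
    have "\<exists>d. lcons (list_encode \<Gamma>) 0 = lcons d 0 \<and>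
        (\<forall>i\<in>set (list_decode d). i \<in> set (list_decode (list_encode \<Delta>)))"
      using weaken.hyps(2) by (intro exI[of _ "list_encode \<Gamma>"]) auto
    then have "refutable_rule L S (lcons (list_encode \<Gamma>) 0) (list_encode \<Delta>)"
      unfolding refutable_rule_def by blast
    then show ?case by (rule rule_closure.intros) (use weaken.IH in auto)
  next
    case (cut p e \<Gamma>)
    have "refutable_rule L S (lcons (list_encode (pair p e # \<Gamma>))
        (lcons (list_encode (pair (neg_code p) e # \<Gamma>)) 0)) (list_encode \<Gamma>)"
      unfolding refutable_rule_def list_encode_Cons by blast
    then show ?case by (rule rule_closure.intros) (use cut.IH in auto)
  next
    case (witness p x y e \<Gamma>)
    have "refutable_rule L S (lcons (list_encode (pair (neg_code p) (lcons (pair x (pair 0 y)) e) #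
        pair (neg_code (all_code x p)) e # \<Gamma>)) 0) (list_encode (pair (neg_code (all_code x p)) e # \<Gamma>))"
      using witness.hyps(2) unfolding refutable_rule_def list_encode_Cons by blast
    then show ?case by (rule rule_closure.intros) (use witness.IH in auto)
  \<comment> \<open>The remaining cases are the rules without premises; the disjuncts are tried in
    turn until one fits.\<close>
  qed ((rule ax, unfold refutable_rule_def list_encode_Cons list_encode.simps(1),
      (((rule disjI1)?, (intro exI conjI; (rule HOL.refl | assumption))) | rule disjI2)+)[1])+
  then show "refutable L S (list_decode c) \<Longrightarrow> rule_closure (refutable_rule L S) c" by fastforce
next
  assume "rule_closure (refutable_rule L S) c"
  then show "refutable L S (list_decode c)"
  proof induction
    case (1 ps c)
    note IH = "1.IH"
    from 1(1) show ?case
      unfolding refutable_rule_def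
    proof (elim disjE exE conjE, goal_cases)
      case (9 f ts ss)
      then show ?case using refutable.cong[of ts ss L S f] by simp
    next
      case (12 d)
      then show ?case using weaken[of L S "list_decode d" "list_decode c"] IH by auto
    next
      case (13 p e)
      then show ?case using cut[of L S p e "list_decode c"] IH[of "lcons (pair p e) c"] IH[of "lcons (pair (neg_code p) e) c"]
        by simp
    next
      case (14 p x y e d)
      from \<open>c < y\<close> have "list_encode (list_decode c) < y" by (simp only: list_decode_inverse)
      then have "list_encode (pair (neg_code (all_code x p)) e # list_decode d) < y" using 14 by (simp only: list_decode_lcons)
      with 14 show ?case using refutable.witness[of L S p x y e "list_decode d"]
          IH[of "lcons (pair (neg_code p) (lcons (pair x (pair 0 y)) e)) c"] by simp
    qed (simp_all add: refutable.contra conj1 conj2 conj3 refutable.all axiom refutable.refl euclid inst1 inst2)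
  qed
qed

lemma semidecid_refutable:
  assumes "finite_type L" "decidable S"
  shows "semidecid (\<lambda>c. refutable L S (list_decode c))"
  unfolding refutable_iff_rule_closure
  by (intro semidecid_rule_closure semidecid_refutable_rule assms)

section \<open>Finite algebras\<close>

text \<open>The code \<open>x\<close> is a pair of the largest element of the carrier and an operation table, which is a
  list indexed by the codes of pairs of a symbol and an argument list. Every \<open>x\<close> codes an algebra:
  the minimum keeps the values in the carrier.\<close>

definition fin_alg :: "nat \<Rightarrow> nat alg" where
  "fin_alg x = \<lparr>carrier = {..pfst x},
     oper = (\<lambda>f xs. min (pfst x) (lnth (psnd x) (pair f (list_encode xs))))\<rparr>"

lemma carrier_fin_alg: "carrier (fin_alg x) = {0..<Suc (pfst x)}"
  by (auto simp: fin_alg_def)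

text \<open>The association lists of substitutions are reused. The minimum forces all values,
  including the default of \<open>lookup\<close>, into the carrier.\<close>

definition assignment :: "nat \<Rightarrow> nat \<Rightarrow> nat \<Rightarrow> nat" where
  "assignment x e n = min (pfst x) (lookup (list_decode e) n)"

lemma algebra_fin_alg: "algebra L (fin_alg x)"
  by (auto simp: algebra_def fin_alg_def)

lemma range_assignment: "range (assignment x e) \<subseteq> carrier (fin_alg x)"
  by (auto simp: fin_alg_def assignment_def)

lemma recursive_min [recur]: "recursive f \<Longrightarrow> recursive g \<Longrightarrow> recursive (\<lambda>x. min (f x) (g x))"
  unfolding min_def by (intro recur)

lemma recursive_eval_fin_alg:
  assumes "recursive f" "recursive g" "recursive h"
  shows "recursive (\<lambda>z. eval (fin_alg (f z)) (assignment (f z) (g z)) (trm_of (h z)))"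
proof -
  have "recursive (\<lambda>z. eval (fin_alg (pfst (pfst z))) (assignment (pfst (pfst z)) (psnd (pfst z))) (trm_of (psnd z)))"
    \<comment> \<open>Apart from the parameter, \<open>b\<close> receives the pair of the symbol and
      the coded list of argument values, which is the index into the operation table.\<close>
    by (rule recursive_trm_fold[where a = "\<lambda>w. assignment (pfst (pfst w)) (psnd (pfst w)) (psnd w)"
          and b = "\<lambda>w. min (pfst (pfst (pfst w))) (lnth (psnd (pfst (pfst w))) (psnd w))"])
      (simp, simp add: fin_alg_def, unfold assignment_def, (intro recur)+)
  from recursive_comp[OF this recursive_pair[OF recursive_pair[OF assms(1,2)] assms(3)]]
  show ?thesis by simp
qed

lemma assignment_lcons:
  "a \<le> pfst x \<Longrightarrow> assignment x (lcons (pair y a) e) = (assignment x e)(y := a)"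
  by (auto simp: assignment_def fun_eq_iff)

lemma decid_sat_fin_alg:
  assumes "recursive f" "recursive g" "recursive h"
  shows "decid (\<lambda>z. sat (fin_alg (f z)) (assignment (f z) (g z)) (fm_of (h z)))"
proof -
  let ?f = "\<lambda>x p. of_bool (sat (fin_alg (pfst x)) (assignment (pfst x) (psnd x)) p) :: nat"
  have "recursive (\<lambda>z. ?f (pfst z) (fm_of (psnd z)))"
  \<comment> \<open>A quantifier becomes a conjunction over the \<open>Suc (pfst (pfst x))\<close>
    elements of the carrier: \<open>e\<close> puts the quantified variable with its value in front
    of the assignment, where it overrides earlier entries.\<close>
  proof (rule recursive_fm_fold[where f = ?f and b = "\<lambda>v. 1 - v" and c = "\<lambda>v. of_bool (pfst v = 1 \<and> psnd v = 1)"
        and d = "\<lambda>v. of_bool (\<forall>y\<in>set (list_decode (psnd v)). y = 1)"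
        and e = "\<lambda>v. pair (pfst (pfst (psnd v))) (lcons (pair (psnd (psnd v)) (pfst v)) (psnd (pfst (psnd v))))"
        and n = "\<lambda>x. Suc (pfst (pfst x))"])
    show "?f x (Forall y p) = of_bool (\<forall>v\<in>set (list_decode (psnd (pair y (ltab (\<lambda>i. ?f (pair
        (pfst (pfst (psnd (pair i (pair x y)))))
        (lcons (pair (psnd (psnd (pair i (pair x y)))) (pfst (pair i (pair x y))))
          (psnd (pfst (psnd (pair i (pair x y))))))) p) (Suc (pfst (pfst x))))))). v = 1)" for x y p
      by (auto simp: assignment_lcons carrier_fin_alg simp del: upt_Suc)
    show "recursive (\<lambda>z. ?f (pfst z) (Eq (trm_of (pfst (psnd z))) (trm_of (psnd (psnd z)))))"
      by (simp del: of_bool_eq_iff) (intro recur recursive_eval_fin_alg)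
  qed (simp, simp, intro recur, intro recur, intro recur, intro recur, intro recur)
  from recursive_comp[OF this recursive_pair[OF recursive_pair[OF assms(1,2)] assms(3)]]
  show ?thesis by (simp add: decid_def of_bool_def)
qed

section \<open>Isomorphic copies of algebras\<close>

text \<open>Isomorphisms carry quotients of the term algebra and coded finite algebras into the type
  \<open>'a\<close>, and finite algebras over \<open>'a\<close> to coded ones.\<close>

definition alg_iso :: "lang \<Rightarrow> ('a \<Rightarrow> 'b) \<Rightarrow> 'a alg \<Rightarrow> 'b alg \<Rightarrow> bool" where
  "alg_iso L h A B \<longleftrightarrow> bij_betw h (carrier A) (carrier B) \<and>
    (\<forall>f xs. L f = Some (length xs) \<longrightarrow> set xs \<subseteq> carrier A \<longrightarrow>
      oper B f (map h xs) = h (oper A f xs))"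

lemma alg_iso_eval:
  assumes "alg_iso L h A B" "algebra L A" "range v \<subseteq> carrier A" "is_term L t"
  shows "eval B (\<lambda>n. h (v n)) t = h (eval A v t)"
  using assms(4)
proof (induction t)
  case (Fn f ts)
  then have "map (eval B (\<lambda>n. h (v n))) ts = map h (map (eval A v) ts)" by auto
  moreover have "set (map (eval A v) ts) \<subseteq> carrier A"
    using Fn.prems eval_in_carrier[OF assms(2,3)] by auto
  moreover have "L f = Some (length (map (eval A v) ts))" using Fn.prems by simp
  ultimately show ?case
    using assms(1) unfolding alg_iso_def by (simp only: eval.simps)
qed simp

lemma alg_iso_sat:
  assumes "alg_iso L h A B" "algebra L A" "range v \<subseteq> carrier A" "is_fm L p"
  shows "sat B (\<lambda>n. h (v n)) p = sat A v p"
  using assms(3,4)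
proof (induction p arbitrary: v)
  case (Eq t s)
  have "inj_on h (carrier A)" using assms(1) by (simp add: alg_iso_def bij_betw_def)
  then show ?case
    using Eq alg_iso_eval[OF assms(1,2) Eq.prems(1)] eval_in_carrier[OF assms(2) Eq.prems(1)]
    by (auto dest: inj_onD)
next
  case (Forall x p)
  have B: "carrier B = h ` carrier A" using assms(1) by (simp add: alg_iso_def bij_betw_def)
  have "sat B ((\<lambda>n. h (v n))(x := h a)) p = sat A (v(x := a)) p" if "a \<in> carrier A" for a
  proof -
    have "(\<lambda>n. h (v n))(x := h a) = (\<lambda>n. h ((v(x := a)) n))" by auto
    moreover have "range (v(x := a)) \<subseteq> carrier A" using that Forall.prems(1) by auto
    ultimately show ?thesis using Forall.IH[of "v(x := a)"] Forall.prems(2) by (simp only: is_fm.simps)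
  qed
  then show ?case by (simp add: B)
qed simp_all

lemma alg_iso_algebra:
  assumes "alg_iso L h A B" "algebra L A" shows "algebra L B"
proof -
  have B: "carrier B = h ` carrier A" using assms(1) by (simp add: alg_iso_def bij_betw_def)
  have "oper B f ys \<in> carrier B" if "L f = Some (length ys)" "set ys \<subseteq> carrier B" for f ys
  proof -
    define xs where "xs = map (inv_into (carrier A) h) ys"
    have ys: "ys = map h xs" and xs: "set xs \<subseteq> carrier A"
      using that(2) unfolding B xs_def
      by (auto simp: subset_iff f_inv_into_f inv_into_into intro!: map_idI[symmetric])
    have "oper A f xs \<in> carrier A" using assms(2) that(1) xs by (simp add: algebra_def ys)
    moreover have "oper B f ys = h (oper A f xs)" using assms(1) that(1) xs by (simp add: alg_iso_def ys)
    ultimately show ?thesis by (simp add: B)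
  qed
  then show ?thesis using assms(2) by (auto simp: B algebra_def)
qed

lemma alg_iso_valid:
  assumes iso: "alg_iso L h A B" "algebra L A" and p: "is_fm L p"
  shows "valid B p \<longleftrightarrow> valid A p"
proof
  assume "valid B p"
  have "sat A v p" if "range v \<subseteq> carrier A" for v
  proof -
    have "carrier B = h ` carrier A" using iso(1) by (simp add: alg_iso_def bij_betw_def)
    then have "range (\<lambda>n. h (v n)) \<subseteq> carrier B" using that by auto
    then show ?thesis using alg_iso_sat[OF iso that p] \<open>valid B p\<close> by (simp add: valid_def)
  qed
  then show "valid A p" by (simp add: valid_def)
next
  assume "valid A p"
  have bij: "bij_betw h (carrier A) (carrier B)" using iso(1) by (simp add: alg_iso_def)
  have "sat B w p" if w: "range w \<subseteq> carrier B" for w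
  proof -
    let ?v = "\<lambda>n. inv_into (carrier A) h (w n)"
    have "w n \<in> h ` carrier A" for n using w bij by (auto simp: bij_betw_def)
    then have "h (?v n) = w n" "?v n \<in> carrier A" for n
      by (simp_all add: f_inv_into_f inv_into_into)
    then have "(\<lambda>n. h (?v n)) = w" "range ?v \<subseteq> carrier A" by auto
    with alg_iso_sat[OF iso this(2) p] \<open>valid A p\<close> show ?thesis by (simp add: valid_def)
  qed
  then show "valid B p" by (simp add: valid_def)
qed

lemma alg_iso_Mod:
  assumes "alg_iso L h A B" "algebra L A" "\<And>p. p \<in> S \<Longrightarrow> is_fm L p"
  shows "B \<in> Mod L S \<longleftrightarrow> A \<in> Mod L S"
  using alg_iso_valid[OF assms(1,2)] alg_iso_algebra[OF assms(1,2)] assms(2,3) by (auto simp: Mod_def)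

lemma alg_iso_image:
  assumes "inj_on h (carrier A)"
  obtains B where "alg_iso L h A B"
proof -
  let ?B = "\<lparr>carrier = h ` carrier A, oper = (\<lambda>f ys. h (oper A f (map (inv_into (carrier A) h) ys)))\<rparr>"
  have "map (inv_into (carrier A) h) (map h xs) = xs" if "set xs \<subseteq> carrier A" for xs
    using that assms by (induction xs) auto
  then have "alg_iso L h A ?B"
    using assms by (auto simp: alg_iso_def bij_betw_def simp del: map_map)
  then show ?thesis by (rule that)
qed

lemma lookup_map_pair: "n \<in> set ns \<Longrightarrow> lookup (map (\<lambda>n. pair n (g n)) ns) n = g n"
  by (induction ns) auto

lemma finite_alg_coded:
  assumes L: "finite_type L" and A: "algebra L A" "finite (carrier A)"
  obtains x h where "alg_iso L h A (fin_alg x)"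
proof -
  obtain k where k: "card (carrier A) = Suc k"
    using A by (metis algebra_def card_eq_0_iff not0_implies_Suc)
  obtain h where "bij_betw h (carrier A) {0..<card (carrier A)}"
    using ex_bij_betw_finite_nat[OF A(2)] by blast
  moreover have "{0..<card (carrier A)} = {..k}" using k by auto
  ultimately have h: "bij_betw h (carrier A) {..k}" by simp
  \<comment> \<open>Only the table entries with index in \<open>?K\<close> matter. Finite language
    and finite carrier make them finitely many, so a table of some length \<open>N\<close> reaches
    them all.\<close>
  let ?K = "(\<lambda>(f, ys). pair f (list_encode ys)) `
    (SIGMA f:dom L. {ys. set ys \<subseteq> {..k} \<and> length ys = the (L f)})"
  have "finite ?K"
    using L by (intro finite_imageI finite_SigmaI finite_lists_length_eq) (auto simp: finite_type_def)
  then obtain N where N: "\<forall>i\<in>?K. i < N" using finite_nat_set_iff_bounded by blast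
  let ?F = "\<lambda>i. h (oper A (pfst i) (map (inv_into (carrier A) h) (list_decode (psnd i))))"
  let ?x = "pair k (ltab ?F N)"
  have "alg_iso L h A (fin_alg ?x)"
    unfolding alg_iso_def
  proof (intro conjI allI impI)
    show "bij_betw h (carrier A) (carrier (fin_alg ?x))" using h by (simp add: fin_alg_def)
    fix f xs assume f: "L f = Some (length xs)" and xs: "set xs \<subseteq> carrier A"
    have inv: "map (inv_into (carrier A) h) (map h xs) = xs"
      using xs h by (induction xs) (auto simp: bij_betw_def)
    have "oper A f xs \<in> carrier A" using A(1) f xs by (auto simp: algebra_def)
    then have le: "h (oper A f xs) \<le> k" using h by (auto simp: bij_betw_def)
    have "set (map h xs) \<subseteq> {..k}" using xs h by (auto simp: bij_betw_def)
    then have "pair f (list_encode (map h xs)) \<in> ?K"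
      using f by (intro image_eqI[of _ _ "(f, map h xs)"]) auto
    with N have "pair f (list_encode (map h xs)) < N" by blast
    then have "lnth (ltab ?F N) (pair f (list_encode (map h xs))) = h (oper A f xs)"
      by (simp add: inv del: map_map)
    with le show "oper (fin_alg ?x) f (map h xs) = h (oper A f xs)" by (simp add: fin_alg_def)
  qed
  then show ?thesis by (rule that)
qed

section \<open>Counterexamples in finite subalgebras\<close>

text \<open>For subalgebras, which keep \<open>oper\<close> and only shrink the carrier.\<close>

lemma eval_oper_cong: "oper A = oper B \<Longrightarrow> eval A v t = eval B v t"
proof (induction t)
  case (Fn f ts)
  then have "map (eval A v) ts = map (eval B v) ts" by simp
  with Fn.prems show ?case by (simp only: eval.simps)
qed simp

lemma generated_subset_carrier:
  assumes "algebra L A" "X \<subseteq> carrier A" shows "generated L A X \<subseteq> carrier A"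
proof
  fix a assume "a \<in> generated L A X"
  then show "a \<in> carrier A"
  proof induction
    case (step f xs)
    then have "set xs \<subseteq> carrier A" by blast
    with step.hyps(1) assms(1) show ?case by (simp add: algebra_def)
  qed (use assms(2) in auto)
qed

text \<open>The values of the variables in the equation generate a finite subalgebra, which still
  violates it. The subalgebra stays in \<open>V\<close> because equations pass to subalgebras; here
  the equational axioms are used, since arbitrary first-order axioms need not be inherited.\<close>

lemma finite_counterexample:
  fixes V :: "'a alg set"
  assumes "locally_finite L V" "variety L V" "A \<in> V" "\<not> valid A (Eq t s)"
  obtains A0 v where "A0 \<in> V" "finite (carrier A0)" "range v \<subseteq> carrier A0" "eval A0 v t \<noteq> eval A0 v s"
proof -
  obtain E where E: "E \<subseteq> equations L" "V = Mod L E" using assms(2) by (auto simp: variety_def)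
  have A: "algebra L A" using assms(3) E by (simp add: Mod_def)
  obtain v where v: "range v \<subseteq> carrier A" "eval A v t \<noteq> eval A v s"
    using assms(4) by (auto simp: valid_def)
  let ?T = "tvars t \<union> tvars s"
  have "finite (tvars u)" for u by (induction u) auto
  then have "finite (insert (v 0) (v ` ?T))" by simp
  \<comment> \<open>The element \<open>v 0\<close> keeps the generating set nonempty when no
    variable occurs in the equation.\<close>
  define X where "X = insert (v 0) (v ` ?T)"
  define G where "G = generated L A X"
  have X: "finite X" "X \<subseteq> carrier A" "X \<subseteq> G"
    using v(1) \<open>finite (insert _ _)\<close> by (auto simp: X_def G_def intro: generated.base)
  then have "finite G" using assms(1,3) by (simp add: locally_finite_def G_def)
  have sub: "G \<subseteq> carrier A" using generated_subset_carrier[OF A X(2)] by (simp add: G_def)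
  let ?A0 = "A\<lparr>carrier := G\<rparr>"
  have "algebra L ?A0"
    using X(3) by (auto simp: algebra_def X_def G_def intro!: generated.step)
  moreover have "valid ?A0 p" if "p \<in> E" for p
  proof -
    obtain t s where p: "p = Eq t s" using \<open>p \<in> E\<close> E(1) unfolding equations_def by blast
    have "valid A p" using that assms(3) E by (simp add: Mod_def)
    then show ?thesis
      using sub eval_oper_cong[of ?A0 A] by (auto simp: p valid_def dest: subset_trans)
  qed
  ultimately have "?A0 \<in> V" by (simp add: E Mod_def)
  \<comment> \<open>At variables outside the two terms, \<open>v\<close> may leave \<open>G\<close>;
    there it is redirected to the generator \<open>v 0\<close>.\<close>
  define w where "w n = (if n \<in> ?T then v n else v 0)" for n
  have "eval A w t = eval A v t" "eval A w s = eval A v s"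
    by (auto intro!: eval_cong simp: w_def)
  then have "eval ?A0 w t \<noteq> eval ?A0 w s" using v(2) eval_oper_cong[of ?A0 A] by simp
  moreover have "range w \<subseteq> carrier ?A0" using X(3) by (auto simp: w_def X_def)
  ultimately show ?thesis using that[of ?A0 w] \<open>?A0 \<in> V\<close> \<open>finite G\<close> by simp
qed

section \<open>Universal sentences in quotients of the term algebra\<close>

text \<open>A class is determined by any representative and a term by its code, so the carrier is
  countable and embeds into every infinite type.\<close>

lemma quot_alg_embedding:
  assumes "infinite (UNIV :: 'a set)" "term_cong L \<Theta>"
  obtains h :: "trm set \<Rightarrow> 'a" where "inj_on h (carrier (quot_alg L \<Theta>))"
proof -
  have equiv: "equiv {t. is_term L t} \<Theta>" using assms(2) by (simp add: term_cong_def)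
  obtain g :: "nat \<Rightarrow> 'a" where g: "inj g" using assms(1) infinite_countable_subset by blast
  let ?rep = "\<lambda>c. SOME t. t \<in> c"
  have rep: "?rep c \<in> c" if "c \<in> {t. is_term L t} // \<Theta>" for c
    using in_quotient_imp_non_empty[OF equiv that] by (auto intro: someI)
  have "inj_on (\<lambda>c. g (trm_code (?rep c))) ({t. is_term L t} // \<Theta>)"
  proof (rule inj_onI)
    fix c d assume c: "c \<in> {t. is_term L t} // \<Theta>" and d: "d \<in> {t. is_term L t} // \<Theta>"
      and "g (trm_code (?rep c)) = g (trm_code (?rep d))"
    then have "?rep c = ?rep d" using g by (simp add: inj_eq trm_code_inject)
    then show "c = d" using quotient_disj[OF equiv c d] rep[OF c] rep[OF d] by auto
  qed
  then show ?thesis by (intro that) (simp add: quot_alg_def)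
qed

lemma valid_foldr_Forall:
  assumes "algebra L A" shows "valid A (foldr Forall xs p) \<longleftrightarrow> valid A p"
proof (induction xs)
  case (Cons x xs)
  have "valid A (Forall x q) \<longleftrightarrow> valid A q" for q
  proof
    assume all: "valid A (Forall x q)"
    show "valid A q"
      unfolding valid_def
    proof (intro allI impI)
      fix v :: "nat \<Rightarrow> _" assume v: "range v \<subseteq> carrier A"
      then have "sat A (v(x := v x)) q" using all by (auto simp: valid_def simp del: fun_upd_triv)
      then show "sat A v q" by simp
    qed
  next
    assume "valid A q"
    then show "valid A (Forall x q)" by (auto simp: valid_def image_subset_iff)
  qed
  with Cons show ?case by simp
qed simp

lemma fvars_foldr_Forall: "fvars (foldr Forall xs p) = fvars p - set xs"
  by (induction xs) auto

lemma is_fm_foldr_Forall: "is_fm L (foldr Forall xs p) = is_fm L p"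
  by (induction xs) auto

lemma finite_tvars: "finite (tvars t)"
  by (induction t) auto

lemma finite_fvars: "finite (fvars p)"
  by (induction p) (auto simp: finite_tvars)

section \<open>Universal formulas and substitutions of terms\<close>

text \<open>Closedness is dropped, so that quantifiers can be stripped one at a time and open
  equations are covered as well.\<close>

definition prenex_universal :: "fm \<Rightarrow> bool" where
  "prenex_universal p \<longleftrightarrow> (\<exists>xs q. qfree q \<and> p = foldr Forall xs q)"

text \<open>Universal quantifiers are skipped: only prenex formulas are of interest here.\<close>

primrec matrix_holds :: "(trm \<times> trm) set \<Rightarrow> (nat \<Rightarrow> trm) \<Rightarrow> fm \<Rightarrow> bool" where
  "matrix_holds \<Theta> \<sigma> (Eq t s) \<longleftrightarrow> (subst \<sigma> t, subst \<sigma> s) \<in> \<Theta>"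
| "matrix_holds \<Theta> \<sigma> (Neg p) \<longleftrightarrow> \<not> matrix_holds \<Theta> \<sigma> p"
| "matrix_holds \<Theta> \<sigma> (Conj p q) \<longleftrightarrow> matrix_holds \<Theta> \<sigma> p \<and> matrix_holds \<Theta> \<sigma> q"
| "matrix_holds \<Theta> \<sigma> (Forall x p) \<longleftrightarrow> matrix_holds \<Theta> \<sigma> p"

lemma subst_cong: "(\<And>n. n \<in> tvars t \<Longrightarrow> \<sigma> n = \<tau> n) \<Longrightarrow> subst \<sigma> t = subst \<tau> t"
  by (induction t) auto

lemma matrix_holds_cong:
  "qfree p \<Longrightarrow> (\<And>n. n \<in> fvars p \<Longrightarrow> \<sigma> n = \<tau> n) \<Longrightarrow> matrix_holds \<Theta> \<sigma> p = matrix_holds \<Theta> \<tau> p"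
proof (induction p)
  case (Eq t s)
  then have "subst \<sigma> t = subst \<tau> t" "subst \<sigma> s = subst \<tau> s" by (auto intro: subst_cong)
  then show ?case by simp
qed auto

lemma matrix_holds_foldr_Forall: "matrix_holds \<Theta> \<sigma> (foldr Forall xs p) = matrix_holds \<Theta> \<sigma> p"
  by (induction xs) auto

lemma sat_quot_alg_qfree:
  assumes "term_cong L \<Theta>" "\<And>n. is_term L (\<sigma> n)" "qfree p" "is_fm L p"
  shows "sat (quot_alg L \<Theta>) (\<lambda>n. \<Theta> `` {\<sigma> n}) p = matrix_holds \<Theta> \<sigma> p"
  using assms(3,4)
proof (induction p)
  case (Eq t s)
  have equiv: "equiv {t. is_term L t} \<Theta>" using assms(1) by (simp add: term_cong_def)
  have terms: "is_term L (subst \<sigma> t)" "is_term L (subst \<sigma> s)"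
    using Eq assms(2) by (auto intro: is_term_subst)
  have "eval (quot_alg L \<Theta>) (\<lambda>n. \<Theta> `` {\<sigma> n}) t = \<Theta> `` {subst \<sigma> t}"
    "eval (quot_alg L \<Theta>) (\<lambda>n. \<Theta> `` {\<sigma> n}) s = \<Theta> `` {subst \<sigma> s}"
    by (rule eval_quot_alg[OF assms(1,2)]; use Eq in simp)+
  then show ?case using eq_equiv_class_iff[OF equiv] terms by simp
qed auto

text \<open>Lets a search over numbers replace a quantification over all substitutions.\<close>

lemma env_of_substitution:
  assumes "finite X" "\<And>n. is_term L (\<sigma> n)"
  obtains e where "\<forall>d\<in>set (list_decode e). is_term L (trm_of (psnd d))" "\<And>n. n \<in> X \<Longrightarrow> env e n = \<sigma> n"
proof -
  obtain ns where ns: "set ns = X" using finite_list[OF assms(1)] by blast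
  let ?e = "list_encode (map (\<lambda>n. pair n (trm_code (\<sigma> n))) ns)"
  show ?thesis
  proof (rule that[of ?e])
    show "env ?e n = \<sigma> n" if "n \<in> X" for n
      using that lookup_map_pair[of n ns "\<lambda>n. trm_code (\<sigma> n)"] ns by (simp add: env_def)
  qed (auto simp: assms(2))
qed

lemma is_term_env:
  assumes "\<forall>d\<in>set (list_decode e). is_term L (trm_of (psnd d))" shows "is_term L (env e n)"
  using lookup_cases[of "list_decode e" n] assms by (auto simp: env_def)

text \<open>Choosing representatives shows that every valuation comes from a substitution of terms,
  of which only the values at the finitely many variables of the matrix matter.\<close>

lemma valid_quot_alg_iff:
  assumes cong: "term_cong L \<Theta>" and p: "prenex_universal p" "is_fm L p"
  shows "valid (quot_alg L \<Theta>) p \<longleftrightarrow>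
    (\<forall>e. (\<forall>d\<in>set (list_decode e). is_term L (trm_of (psnd d))) \<longrightarrow> matrix_holds \<Theta> (env e) p)"
proof -
  obtain xs q where q: "qfree q" "p = foldr Forall xs q" using p(1) by (auto simp: prenex_universal_def)
  have fm: "is_fm L q" using p(2) by (simp add: q is_fm_foldr_Forall)
  note sat = sat_quot_alg_qfree[OF cong _ q(1) fm]
  have "valid (quot_alg L \<Theta>) p \<longleftrightarrow> valid (quot_alg L \<Theta>) q"
    unfolding q(2) by (rule valid_foldr_Forall[OF algebra_quot_alg[OF cong]])
  also have "\<dots> \<longleftrightarrow> (\<forall>\<sigma>. (\<forall>n. is_term L (\<sigma> n)) \<longrightarrow> matrix_holds \<Theta> \<sigma> q)"
  proof
    assume valid: "valid (quot_alg L \<Theta>) q"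
    show "\<forall>\<sigma>. (\<forall>n. is_term L (\<sigma> n)) \<longrightarrow> matrix_holds \<Theta> \<sigma> q"
    proof (intro allI impI)
      fix \<sigma> :: "nat \<Rightarrow> trm" assume \<sigma>: "\<forall>n. is_term L (\<sigma> n)"
      have "range (\<lambda>n. \<Theta> `` {\<sigma> n}) \<subseteq> carrier (quot_alg L \<Theta>)"
        using \<sigma> by (auto simp: quot_alg_def intro: quotientI)
      with valid sat[of \<sigma>] \<sigma> show "matrix_holds \<Theta> \<sigma> q" by (simp add: valid_def)
    qed
  next
    assume *: "\<forall>\<sigma>. (\<forall>n. is_term L (\<sigma> n)) \<longrightarrow> matrix_holds \<Theta> \<sigma> q"
    show "valid (quot_alg L \<Theta>) q"
      unfolding valid_def
    proof (intro allI impI)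
      fix v :: "nat \<Rightarrow> _" assume "range v \<subseteq> carrier (quot_alg L \<Theta>)"
      then obtain \<sigma> where "\<And>n. is_term L (\<sigma> n)" "v = (\<lambda>n. \<Theta> `` {\<sigma> n})"
        by (rule valuation_quot_algE) blast
      with * sat[of \<sigma>] show "sat (quot_alg L \<Theta>) v q" by simp
    qed
  qed
  also have "\<dots> \<longleftrightarrow> (\<forall>e. (\<forall>d\<in>set (list_decode e). is_term L (trm_of (psnd d))) \<longrightarrow> matrix_holds \<Theta> (env e) q)"
  proof
    assume *: "\<forall>e. (\<forall>d\<in>set (list_decode e). is_term L (trm_of (psnd d))) \<longrightarrow> matrix_holds \<Theta> (env e) q"
    show "\<forall>\<sigma>. (\<forall>n. is_term L (\<sigma> n)) \<longrightarrow> matrix_holds \<Theta> \<sigma> q"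
    proof (intro allI impI)
      fix \<sigma> :: "nat \<Rightarrow> trm" assume "\<forall>n. is_term L (\<sigma> n)"
      then obtain e where "\<forall>d\<in>set (list_decode e). is_term L (trm_of (psnd d))"
        "\<And>n. n \<in> fvars q \<Longrightarrow> env e n = \<sigma> n"
        using env_of_substitution[OF finite_fvars[of q], of L \<sigma>] by blast
      with * matrix_holds_cong[OF q(1), of "env e" \<sigma>] show "matrix_holds \<Theta> \<sigma> q" by blast
    qed
  qed (use is_term_env in blast)
  finally show ?thesis by (simp add: q(2) matrix_holds_foldr_Forall)
qed

text \<open>The rank is 2 for quantifier-free formulas, 1 for universal formulas with a quantifier, and 0 for
  all others; formulas with symbols outside \<open>L\<close> or with free variables outside \<open>ns\<close> have rank 0.\<close>

primrec universal_rank :: "lang \<Rightarrow> nat list \<Rightarrow> fm \<Rightarrow> nat" where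
  "universal_rank L ns (Eq t s) =
     (if is_term L t \<and> is_term L s \<and> tvars t \<subseteq> set ns \<and> tvars s \<subseteq> set ns then 2 else 0)"
| "universal_rank L ns (Neg p) = (if universal_rank L ns p = 2 then 2 else 0)"
| "universal_rank L ns (Conj p q) =
     (if universal_rank L ns p = 2 \<and> universal_rank L ns q = 2 then 2 else 0)"
| "universal_rank L ns (Forall x p) = (if universal_rank L (x # ns) p = 0 then 0 else 1)"

lemma universal_rank_eq_2_iff:
  "universal_rank L ns p = 2 \<longleftrightarrow> qfree p \<and> is_fm L p \<and> fvars p \<subseteq> set ns"
  by (induction p arbitrary: ns) auto

lemma prenex_universal_simps:
  "prenex_universal (Eq t s)"
  "prenex_universal (Neg p) \<longleftrightarrow> qfree p"
  "prenex_universal (Conj p q) \<longleftrightarrow> qfree p \<and> qfree q"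
  "prenex_universal (Forall x p) \<longleftrightarrow> prenex_universal p"
proof -
  have *: "prenex_universal p \<longleftrightarrow> qfree p" if "\<And>x q. p \<noteq> Forall x q" for p
  proof
    assume "prenex_universal p"
    then obtain xs q where "qfree q" "p = foldr Forall xs q" by (auto simp: prenex_universal_def)
    with that show "qfree p" by (cases xs) auto
  next
    assume "qfree p"
    then show "prenex_universal p" unfolding prenex_universal_def by (intro exI[of _ "[]"]) auto
  qed
  show "prenex_universal (Eq t s)" "prenex_universal (Neg p) \<longleftrightarrow> qfree p"
    "prenex_universal (Conj p q) \<longleftrightarrow> qfree p \<and> qfree q" by (simp_all add: *)
  show "prenex_universal (Forall x p) \<longleftrightarrow> prenex_universal p"
  proof
    assume "prenex_universal (Forall x p)"
    then obtain xs q where "qfree q" "Forall x p = foldr Forall xs q" by (auto simp: prenex_universal_def)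
    then show "prenex_universal p" by (cases xs) (auto simp: prenex_universal_def)
  next
    assume "prenex_universal p"
    then obtain xs q where "qfree q" "p = foldr Forall xs q" by (auto simp: prenex_universal_def)
    then show "prenex_universal (Forall x p)"
      unfolding prenex_universal_def by (intro exI[of _ "x # xs"]) auto
  qed
qed

lemma universal_rank_neq_0_iff:
  "universal_rank L ns p \<noteq> 0 \<longleftrightarrow> prenex_universal p \<and> is_fm L p \<and> fvars p \<subseteq> set ns"
proof (induction p arbitrary: ns)
  case (Forall x p)
  have "universal_rank L ns (Forall x p) \<noteq> 0 \<longleftrightarrow> universal_rank L (x # ns) p \<noteq> 0" by simp
  also have "\<dots> \<longleftrightarrow> prenex_universal p \<and> is_fm L p \<and> fvars p \<subseteq> set (x # ns)" by (rule Forall.IH)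
  finally show ?case by (auto simp: prenex_universal_simps)
qed (simp_all add: prenex_universal_simps universal_rank_eq_2_iff)

lemma universal_sentences_iff: "p \<in> universal_sentences L \<longleftrightarrow> universal_rank L [] p \<noteq> 0"
  unfolding universal_rank_neq_0_iff universal_sentences_def sentences_def prenex_universal_def by auto

lemma recursive_universal_rank:
  assumes "finite_type L" "recursive f" "recursive g"
  shows "recursive (\<lambda>x. universal_rank L (list_decode (f x)) (fm_of (g x)))"
proof -
  have "recursive (\<lambda>z. of_bool (tvars (trm_of (psnd z)) \<subseteq> set (list_decode (pfst z))))"
    by (rule recursive_trm_fold[where f = "\<lambda>x t. of_bool (tvars t \<subseteq> set (list_decode x))"
          and a = "\<lambda>z. of_bool (psnd z \<in> set (list_decode (pfst z)))"
          and b = "\<lambda>z. of_bool (\<forall>v\<in>set (list_decode (psnd (psnd z))). v = 1)"])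
      (simp, force simp: of_bool_def, intro recur, intro recur)
  from decid_trm_fold[where P = "\<lambda>x t. tvars t \<subseteq> set (list_decode x)", OF this]
  have [recur]: "recursive f \<Longrightarrow> recursive g \<Longrightarrow> decid (\<lambda>x. tvars (trm_of (g x)) \<subseteq> set (list_decode (f x)))"
    for f g .
  note decid_is_term[OF assms(1), recur]
  have "recursive (\<lambda>z. universal_rank L (list_decode (pfst z)) (fm_of (psnd z)))"
    by (rule recursive_fm_fold[where f = "\<lambda>x p. universal_rank L (list_decode x) p"
          and b = "\<lambda>v. if v = 2 then 2 else 0" and c = "\<lambda>v. if pfst v = 2 \<and> psnd v = 2 then 2 else 0"
          and d = "\<lambda>v. if lnth (psnd v) 0 = 0 then 0 else 1"
          and e = "\<lambda>v. lcons (psnd (psnd v)) (pfst (psnd v))" and n = "\<lambda>x. 1"])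
      (simp, simp, simp, simp, (intro recur)+)
  from recursive_comp[OF this recursive_pair[OF assms(2,3)]] show ?thesis by simp
qed

text \<open>Since every number decodes to some formula, comparing \<open>x\<close> with
  \<open>fm_code (fm_of x)\<close> tells the genuine codes apart.\<close>

lemma recursive_fm_code: "recursive (\<lambda>x. fm_code (fm_of x))"
proof -
  have "recursive (\<lambda>z. fm_code (fm_of (psnd z)))"
    by (rule recursive_fm_fold[where f = "\<lambda>x p. fm_code p" and b = "pair (Suc 0)" and c = "pair 2"
          and d = "\<lambda>v. pair 3 (pair (pfst v) (lnth (psnd v) 0))" and e = "\<lambda>v. 0" and n = "\<lambda>x. 1"])
      (simp_all add: fm_code_pair recur del: fm_code.simps)
  from recursive_comp[OF this recursive_pair[OF recursive_const recursive_id]] show ?thesis by simp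
qed

lemma decid_matrix_holds:
  assumes "decid (\<lambda>z. (trm_of (pfst z), trm_of (psnd z)) \<in> \<Theta>)" "recursive f" "recursive g"
  shows "decid (\<lambda>x. matrix_holds \<Theta> (env (f x)) (fm_of (g x)))"
proof -
  \<comment> \<open>The substituted terms are written as decoded codes, because the decision
    procedure for \<open>\<Theta>\<close> takes codes as input.\<close>
  have "decid (\<lambda>z. (trm_of (trm_code (subst (env (pfst z)) (trm_of (pfst (psnd z))))),
      trm_of (trm_code (subst (env (pfst z)) (trm_of (psnd (psnd z)))))) \<in> \<Theta>)"
    by (rule decid_comp2[where P = "\<lambda>c d. (trm_of c, trm_of d) \<in> \<Theta>", OF assms(1)]) (intro recur)+
  then have eq: "decid (\<lambda>z. (subst (env (pfst z)) (trm_of (pfst (psnd z))),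
      subst (env (pfst z)) (trm_of (psnd (psnd z)))) \<in> \<Theta>)" by simp
  have "recursive (\<lambda>z. of_bool (matrix_holds \<Theta> (env (pfst z)) (fm_of (psnd z))))"
    by (rule recursive_fm_fold[where f = "\<lambda>x p. of_bool (matrix_holds \<Theta> (env x) p)"
          and b = "\<lambda>v. 1 - v" and c = "\<lambda>v. of_bool (pfst v = 1 \<and> psnd v = 1)"
          and d = "\<lambda>v. lnth (psnd v) 0" and e = "\<lambda>v. pfst (psnd v)" and n = "\<lambda>x. 1"])
      (simp, simp, simp, simp only: matrix_holds.simps, rule recursive_of_bool[OF eq], (intro recur)+)
  from recursive_comp[OF this recursive_pair[OF assms(2,3)]]
  show ?thesis by (simp add: decid_def of_bool_def)
qed

section \<open>Deciding the universal theory\<close>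

lemma free_alg_eq_quot_alg: "free_alg L V = quot_alg L (free_cong L V)"
  by (simp add: free_alg_def quot_alg_def)

lemma term_cong_free_cong: "term_cong L (free_cong L V)"
proof -
  have iff: "(t, s) \<in> free_cong L V \<longleftrightarrow> is_term L t \<and> is_term L s \<and>
    (\<forall>A\<in>V. \<forall>v. range v \<subseteq> carrier A \<longrightarrow> eval A v t = eval A v s)" for t s
    by (auto simp: free_cong_def valid_def)
  have "equiv {t. is_term L t} (free_cong L V)"
    by (rule equivI) (auto simp: iff refl_on_def sym_def trans_def)
  moreover have "(Fn f ts, Fn f ss) \<in> free_cong L V"
    if f: "L f = Some (length ts)" and *: "list_all2 (\<lambda>t s. (t, s) \<in> free_cong L V) ts ss" for f ts ss
  proof -
    have len: "length ss = length ts" using * by (simp add: list_all2_lengthD)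
    have nth: "(ts ! i, ss ! i) \<in> free_cong L V" if "i < length ts" for i
      using list_all2_nthD[OF * that] .
    have "map (eval A v) ts = map (eval A v) ss" if "A \<in> V" "range v \<subseteq> carrier A" for A v
      by (rule nth_equalityI) (use len nth that in \<open>auto simp: iff\<close>)
    moreover have "is_term L t" if "t \<in> set ts \<union> set ss" for t
      using that nth len by (auto simp: iff in_set_conv_nth)
    ultimately show ?thesis unfolding iff using f len by (simp del: map_eq_conv)
  qed
  ultimately show ?thesis by (simp add: term_cong_def)
qed

text \<open>The quotient is a model of its own universal theory, so its copy over \<open>'a\<close>
  is a model of \<open>S\<close>, for which refutations are sound. Conversely, if the negation of
  \<open>p\<close> is not refutable, \<open>p\<close> fails in a term model of \<open>S\<close>; the
  copy of that model over \<open>'a\<close> satisfies \<open>T\<close>, and hence \<open>p\<close>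
  if \<open>p\<close> is valid in the quotient.\<close>

lemma valid_iff_refutable:
  assumes inf: "infinite (UNIV :: 'a set)" and cong: "term_cong L \<Theta>"
    and T: "T = universal_theory L (quot_alg L \<Theta>)"
    and S: "S \<subseteq> sentences L" "(Mod L S :: 'a alg set) = Mod L T"
    and p: "is_fm L p" "prenex_universal p"
  shows "valid (quot_alg L \<Theta>) p \<longleftrightarrow> refutable L S [pair (neg_code (fm_code p)) 0]"
proof
  have T_fm: "is_fm L q" if "q \<in> T" for q
    using that by (simp add: T universal_theory_def universal_sentences_def sentences_def)
  have S_fm: "is_fm L q" if "q \<in> S" for q using that S(1) by (auto simp: sentences_def)
  {
    assume ref: "refutable L S [pair (neg_code (fm_code p)) 0]"
    obtain h :: "trm set \<Rightarrow> 'a" where "inj_on h (carrier (quot_alg L \<Theta>))"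
      using quot_alg_embedding[OF inf cong] .
    then obtain A where A: "alg_iso L h (quot_alg L \<Theta>) A" by (rule alg_iso_image)
    have "quot_alg L \<Theta> \<in> Mod L T"
      using algebra_quot_alg[OF cong] by (simp add: Mod_def T universal_theory_def)
    then have "A \<in> Mod L S"
      using alg_iso_Mod[OF A algebra_quot_alg[OF cong], of T] T_fm S(2) by simp
    then have "sat A v p" if "range v \<subseteq> carrier A" for v
      using refutable_sound[OF _ S(1) ref that] by (simp add: holds_simps) (simp add: holds_def)
    then show "valid (quot_alg L \<Theta>) p"
      using alg_iso_valid[OF A algebra_quot_alg[OF cong] p(1)] by (simp add: valid_def)
  }
  {
    assume valid: "valid (quot_alg L \<Theta>) p"
    show "refutable L S [pair (neg_code (fm_code p)) 0]"
    proof (rule ccontr)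
      assume "\<not> ?thesis"
      then obtain \<Psi> where \<Psi>: "term_cong L \<Psi>" "quot_alg L \<Psi> \<in> Mod L S" "\<not> valid (quot_alg L \<Psi>) p"
        using refutable_complete[OF S(1) p(1)] by blast
      obtain h :: "trm set \<Rightarrow> 'a" where "inj_on h (carrier (quot_alg L \<Psi>))"
        using quot_alg_embedding[OF inf \<Psi>(1)] .
      then obtain A where A: "alg_iso L h (quot_alg L \<Psi>) A" by (rule alg_iso_image)
      have "A \<in> Mod L T"
        using alg_iso_Mod[OF A algebra_quot_alg[OF \<Psi>(1)], of S] S_fm \<Psi>(2) S(2) by simp
      obtain ns where ns: "set ns = fvars p" using finite_list[OF finite_fvars] by blast
      obtain xs q where q: "qfree q" "p = foldr Forall xs q" using p(2) by (auto simp: prenex_universal_def)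
      \<comment> \<open>\<open>T\<close> consists of sentences, so the free variables of
        \<open>p\<close> are bound in front; the result is still prenex.\<close>
      let ?p = "foldr Forall ns p"
      have "?p = foldr Forall (ns @ xs) q" by (simp add: q)
      moreover have "is_fm L ?p" "fvars ?p = {}"
        using p(1) ns by (simp_all add: is_fm_foldr_Forall fvars_foldr_Forall)
      ultimately have "?p \<in> universal_sentences L"
        unfolding universal_sentences_def sentences_def using q(1) by blast
      then have "?p \<in> T"
        using valid by (simp add: T universal_theory_def valid_foldr_Forall[OF algebra_quot_alg[OF cong]])
      then have "valid A ?p" using \<open>A \<in> Mod L T\<close> by (simp add: Mod_def)
      then have "valid A p"
        using valid_foldr_Forall[OF alg_iso_algebra[OF A algebra_quot_alg[OF \<Psi>(1)]]] by simp
      then show False using alg_iso_valid[OF A algebra_quot_alg[OF \<Psi>(1)] p(1)] \<Psi>(3) by simp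
    qed
  }
qed

text \<open>Refuting an equation becomes a search over numbers \<open>x\<close>, coding a finite
  algebra, and \<open>e\<close>, coding an assignment. As the axioms are sentences, a single
  assignment, here that of the empty list 0, suffices to test them. For finite \<open>Ax\<close> the
  matrix is decidable.\<close>

lemma not_free_cong_iff:
  fixes V :: "'a alg set"
  assumes inf: "infinite (UNIV :: 'a set)" and L: "finite_type L" and V: "variety L V" "locally_finite L V"
    and Ax: "Ax \<subseteq> sentences L" "V = Mod L Ax" and terms: "is_term L t" "is_term L s"
  shows "(t, s) \<notin> free_cong L V \<longleftrightarrow> (\<exists>x e. (\<forall>p\<in>Ax. sat (fin_alg x) (assignment x 0) p) \<and>
    eval (fin_alg x) (assignment x e) t \<noteq> eval (fin_alg x) (assignment x e) s)"
proof
  have Ax_fm: "is_fm L p" if "p \<in> Ax" for p using that Ax(1) by (auto simp: sentences_def)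
  {
    assume "(t, s) \<notin> free_cong L V"
    then obtain A where "A \<in> V" "\<not> valid A (Eq t s)" using terms by (auto simp: free_cong_def)
    then obtain A0 v where A0: "A0 \<in> V" "finite (carrier A0)"
      and v: "range v \<subseteq> carrier A0" "eval A0 v t \<noteq> eval A0 v s"
      using finite_counterexample[OF V(2,1)] by blast
    have alg: "algebra L A0" using A0(1) Ax(2) by (simp add: Mod_def)
    obtain x h where iso: "alg_iso L h A0 (fin_alg x)" using finite_alg_coded[OF L alg A0(2)] .
    have "fin_alg x \<in> Mod L Ax" using alg_iso_Mod[OF iso alg, of Ax] Ax_fm A0(1) Ax(2) by simp
    then have sat: "\<forall>p\<in>Ax. sat (fin_alg x) (assignment x 0) p"
      using range_assignment by (auto simp: Mod_def valid_def)
    obtain ns where ns: "set ns = tvars t \<union> tvars s"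
      using finite_list[of "tvars t \<union> tvars s"] finite_tvars by blast
    let ?e = "list_encode (map (\<lambda>n. pair n (h (v n))) ns)"
    have "h (v n) \<le> pfst x" for n
      using iso v(1) by (force simp: alg_iso_def bij_betw_def fin_alg_def)
    then have "assignment x ?e n = h (v n)" if "n \<in> tvars t \<union> tvars s" for n
      using that ns lookup_map_pair[of n ns "\<lambda>n. h (v n)"] by (simp add: assignment_def)
    then have "eval (fin_alg x) (assignment x ?e) t = eval (fin_alg x) (\<lambda>n. h (v n)) t"
      "eval (fin_alg x) (assignment x ?e) s = eval (fin_alg x) (\<lambda>n. h (v n)) s"
      by (auto intro!: eval_cong)
    moreover have "h (eval A0 v t) \<noteq> h (eval A0 v s)"
      using iso v eval_in_carrier[OF alg v(1)] terms
      by (auto simp: alg_iso_def bij_betw_def dest: inj_onD)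
    ultimately have "eval (fin_alg x) (assignment x ?e) t \<noteq> eval (fin_alg x) (assignment x ?e) s"
      using alg_iso_eval[OF iso alg v(1)] terms by simp
    with sat show "\<exists>x e. (\<forall>p\<in>Ax. sat (fin_alg x) (assignment x 0) p) \<and>
      eval (fin_alg x) (assignment x e) t \<noteq> eval (fin_alg x) (assignment x e) s" by blast
  }
  {
    assume "\<exists>x e. (\<forall>p\<in>Ax. sat (fin_alg x) (assignment x 0) p) \<and>
      eval (fin_alg x) (assignment x e) t \<noteq> eval (fin_alg x) (assignment x e) s"
    then obtain x e where sat: "\<forall>p\<in>Ax. sat (fin_alg x) (assignment x 0) p"
      and neq: "eval (fin_alg x) (assignment x e) t \<noteq> eval (fin_alg x) (assignment x e) s" by blast
    have "valid (fin_alg x) p" if "p \<in> Ax" for p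
      unfolding valid_def
    proof (intro allI impI)
      fix v
      have "fvars p = {}" using that Ax(1) by (auto simp: sentences_def)
      then have "sat (fin_alg x) v p = sat (fin_alg x) (assignment x 0) p" by (intro sat_cong) simp
      with sat that show "sat (fin_alg x) v p" by simp
    qed
    then have Mod: "fin_alg x \<in> Mod L Ax" by (simp add: Mod_def algebra_fin_alg)
    \<comment> \<open>The coded algebra has numbers as elements; membership in \<open>V\<close>
      makes sense only for a copy over \<open>'a\<close>.\<close>
    obtain g :: "nat \<Rightarrow> 'a" where "inj g" using inf infinite_countable_subset by blast
    then have "inj_on g (carrier (fin_alg x))" using inj_on_subset by blast
    then obtain A where A: "alg_iso L g (fin_alg x) A" by (rule alg_iso_image)
    have "A \<in> V" using alg_iso_Mod[OF A algebra_fin_alg, of Ax] Ax_fm Mod Ax(2) by simp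
    moreover have "\<not> valid (fin_alg x) (Eq t s)"
      using neq range_assignment[of x e] by (auto simp: valid_def)
    then have "\<not> valid A (Eq t s)" using alg_iso_valid[OF A algebra_fin_alg, of "Eq t s"] terms by simp
    ultimately show "(t, s) \<notin> free_cong L V" by (auto simp: free_cong_def)
  }
qed

theorem theorem2p7:
  fixes L :: lang and V :: "'a alg set"
  assumes "infinite (UNIV :: 'a set)"
    and "finite_type L"
    and "variety L V"
    and "finitely_axiomatizable L V"
    and "locally_finite L V"
    and "recursively_axiomatizable TYPE('a) L (universal_theory L (free_alg L V))"
  shows "decidable (universal_theory L (free_alg L V))"
proof -
  define \<Theta> where "\<Theta> = free_cong L V"
  let ?F = "quot_alg L \<Theta>"
  define T where "T = universal_theory L ?F"
  have cong: "term_cong L \<Theta>" by (simp add: \<Theta>_def term_cong_free_cong)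
  obtain S where S: "S \<subseteq> sentences L" "decidable S" "(Mod L S :: 'a alg set) = Mod L T"
    using assms(6) by (auto simp: recursively_axiomatizable_def free_alg_eq_quot_alg T_def \<Theta>_def)
  obtain Ax where Ax: "Ax \<subseteq> sentences L" "finite Ax" "V = Mod L Ax"
    using assms(4) by (auto simp: finitely_axiomatizable_def)
  note valid_iff = valid_iff_refutable[OF assms(1) cong T_def S(1,3)]
  note [recur] = decid_is_term[OF assms(2)]
  note semidecid_ref = semidecid_comp[OF semidecid_refutable[OF assms(2) S(2)]]
  have V_alg: "algebra L A" if "A \<in> V" for A using that Ax(3) by (simp add: Mod_def)
  \<comment> \<open>The identities of \<open>V\<close> and of its free algebra coincide:
    \<open>\<Theta>\<close> is closed under substitutions, and conversely validity in
    \<open>?F\<close> is applied to the identity substitution, coded by 0.\<close>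
  have \<Theta>_iff: "(t, s) \<in> \<Theta> \<longleftrightarrow> valid ?F (Eq t s)" if "is_term L t" "is_term L s" for t s
  proof -
    have "(subst \<sigma> t, subst \<sigma> s) \<in> \<Theta>" if "(t, s) \<in> \<Theta>" "\<And>n. is_term L (\<sigma> n)" for \<sigma>
    proof -
      have "eval A v (subst \<sigma> t) = eval A v (subst \<sigma> s)" if "A \<in> V" "range v \<subseteq> carrier A" for A v
      proof -
        have "range (\<lambda>n. eval A v (\<sigma> n)) \<subseteq> carrier A"
          using eval_in_carrier[OF V_alg[OF that(1)] that(2)] \<open>\<And>n. is_term L (\<sigma> n)\<close> by auto
        then show ?thesis
          using \<open>(t, s) \<in> \<Theta>\<close> that(1) by (auto simp: eval_subst \<Theta>_def free_cong_def valid_def)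
      qed
      then show ?thesis
        using that \<open>is_term L t\<close> \<open>is_term L s\<close>
        by (auto simp: \<Theta>_def free_cong_def valid_def intro: is_term_subst)
    qed
    moreover have "(subst (env 0) t, subst (env 0) s) \<in> \<Theta>" if "valid ?F (Eq t s)"
      using that valid_quot_alg_iff[OF cong, of "Eq t s"] \<open>is_term L t\<close> \<open>is_term L s\<close>
      by (auto simp: prenex_universal_simps dest!: spec[of _ 0])
    ultimately show ?thesis
      using valid_quot_alg_iff[OF cong, of "Eq t s"] that is_term_env
      by (auto simp: prenex_universal_simps)
  qed
  have decid_\<Theta>: "decid (\<lambda>z. (trm_of (pfst z), trm_of (psnd z)) \<in> \<Theta>)"
  proof (rule decid_of_semidecid)
    \<comment> \<open>Decoding is not injective, so \<open>trm_code (trm_of c)\<close> is used to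
      replace an arbitrary number \<open>c\<close> by the genuine code of its term.\<close>
    let ?eq = "\<lambda>z. eq_code (trm_code (trm_of (pfst z))) (trm_code (trm_of (psnd z)))"
    have "(trm_of (pfst z), trm_of (psnd z)) \<in> \<Theta> \<longleftrightarrow> (is_term L (trm_of (pfst z)) \<and> is_term L (trm_of (psnd z))) \<and>
        refutable L S (list_decode (lcons (pair (neg_code (?eq z)) 0) 0))" for z
      using \<Theta>_iff[of "trm_of (pfst z)" "trm_of (psnd z)"]
        valid_iff[of "Eq (trm_of (pfst z)) (trm_of (psnd z))"]
      by (auto simp: prenex_universal_simps fm_code_pair eq_code_def \<Theta>_def free_cong_def simp del: fm_code.simps)
    moreover have "semidecid (\<lambda>z. (is_term L (trm_of (pfst z)) \<and> is_term L (trm_of (psnd z))) \<and>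
        refutable L S (list_decode (lcons (pair (neg_code (?eq z)) 0) 0)))"
      unfolding code_defs by (intro semidecid_conj semidecid_ref; (rule semidecid_decid)?; intro recur)
    ultimately show "semidecid (\<lambda>z. (trm_of (pfst z), trm_of (psnd z)) \<in> \<Theta>)" by simp
    have "(trm_of (pfst z), trm_of (psnd z)) \<notin> \<Theta> \<longleftrightarrow>
        \<not> (is_term L (trm_of (pfst z)) \<and> is_term L (trm_of (psnd z))) \<or>
        (\<exists>x e. (\<forall>p\<in>Ax. sat (fin_alg x) (assignment x 0) (fm_of (fm_code p))) \<and>
          eval (fin_alg x) (assignment x e) (trm_of (pfst z)) \<noteq>
          eval (fin_alg x) (assignment x e) (trm_of (psnd z)))" for z
      using not_free_cong_iff[OF assms(1-3,5) Ax(1,3), of "trm_of (pfst z)" "trm_of (psnd z)"]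
      by (auto simp: \<Theta>_def free_cong_def)
    moreover have "semidecid (\<lambda>z. \<not> (is_term L (trm_of (pfst z)) \<and> is_term L (trm_of (psnd z))) \<or>
        (\<exists>x e. (\<forall>p\<in>Ax. sat (fin_alg x) (assignment x 0) (fm_of (fm_code p))) \<and>
          eval (fin_alg x) (assignment x e) (trm_of (pfst z)) \<noteq>
          eval (fin_alg x) (assignment x e) (trm_of (psnd z))))"
      by (intro semidecid_disj semidecid_ex semidecid_decid decid_conj;
          intro recur decid_ball_finite[OF Ax(2)] decid_sat_fin_alg recursive_eval_fin_alg)
    ultimately show "semidecid (\<lambda>z. (trm_of (pfst z), trm_of (psnd z)) \<notin> \<Theta>)" by presburger
  qed
  note [recur] = decid_matrix_holds[OF decid_\<Theta>]
  \<comment> \<open>The first conjunct excludes numbers that decode to a universal sentence without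
    being its code.\<close>
  let ?U = "\<lambda>x. fm_code (fm_of x) = x \<and> universal_rank L (list_decode 0) (fm_of x) \<noteq> 0"
  have U: "decid ?U"
    by (intro recur recursive_fm_code recursive_universal_rank[OF assms(2)])
  have rank: "universal_rank L [] p \<noteq> 0 \<longleftrightarrow> prenex_universal p \<and> is_fm L p \<and> fvars p = {}" for p
    using universal_rank_neq_0_iff[of L "[]" p] by simp
  have T_iff: "x \<in> fm_code ` T \<longleftrightarrow> ?U x \<and> valid ?F (fm_of x)" for x
    unfolding T_def universal_theory_def by (auto simp: universal_sentences_iff intro: rev_image_eqI)
  have "x \<in> fm_code ` T \<longleftrightarrow> ?U x \<and> refutable L S (list_decode (lcons (pair (neg_code x) 0) 0))" for x
    using T_iff[of x] rank[of "fm_of x"] valid_iff[of "fm_of x"] by auto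
  moreover have "semidecid (\<lambda>x. ?U x \<and> refutable L S (list_decode (lcons (pair (neg_code x) 0) 0)))"
    unfolding neg_code_def by (rule semidecid_conj[OF semidecid_decid[OF U] semidecid_ref]) (intro recur)
  moreover have "x \<notin> fm_code ` T \<longleftrightarrow> \<not> ?U x \<or>
      (\<exists>e. (\<forall>d\<in>set (list_decode e). is_term L (trm_of (psnd d))) \<and> \<not> matrix_holds \<Theta> (env e) (fm_of x))" for x
    using T_iff[of x] rank[of "fm_of x"] valid_quot_alg_iff[OF cong, of "fm_of x"] by auto
  moreover have "semidecid (\<lambda>x. \<not> ?U x \<or>
      (\<exists>e. (\<forall>d\<in>set (list_decode e). is_term L (trm_of (psnd d))) \<and> \<not> matrix_holds \<Theta> (env e) (fm_of x)))"
    by (rule semidecid_disj[OF semidecid_decid[OF decid_not[OF U]]]) (intro semidecid_ex semidecid_decid recur)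
  ultimately have "decid (\<lambda>x. x \<in> fm_code ` T)" by (intro decid_of_semidecid) presburger+
  then show ?thesis
    by (simp add: decidable_def recursive_set_iff_decid free_alg_eq_quot_alg T_def \<Theta>_def)
qed

end
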